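(* The Leibniz class of assertional logics is meet-prime among logics with theorems. That is: for every pair $\mathbb K_1,\mathbb K_2$ of Leibniz classes all of whose members are logics with theorems, if every logic in $\mathbb K_1\cap\mathbb K_2$ is assertional, then either every logic in $\mathbb K_1$ is assertional or every logic in $\mathbb K_2$ is assertional.
   Context: Languages and logics. An algebraic language is a set of function symbols of positive finite arity (constants are treated as unary symbols). For a language $\mathcal{L}$ and an infinite cardinal $\kappa$, $Fm_{\mathcal{L}}(\kappa)$ is the set (and absolutely free algebra) of $\mathcal{L}$-terms, called formulas, over variables $\{x_\alpha : \alpha<\kappa\}$. A logic $\vdash$ is a consequence relation on $Fm_{\mathcal L}(\kappa)$, for some $\mathcal L$ and some infinite $\kappa$ (a relation between sets of formulas and formulas such that $\Gamma\vdash\gamma$ for $\gamma\in\Gamma$, and if $\Gamma\vdash\delta$ for all $\delta\in\Delta$ and $\Delta\vdash\varphi$ then $\Gamma\vdash\varphi$) that is substitution invariant ($\Gamma\vdash\varphi$ implies $\sigma[\Gamma]\vdash\sigma(\varphi)$ for every endomorphism $\sigma$ of the formula algebra). Finitarity is not assumed. Its language is $\mathcal L_\vdash$. A logic has theorems if $\emptyset\vdash\varphi$ for some formula $\varphi$. Matrices. A matrix is a pair $\langle \boldsymbol A,F\rangle$ with $\boldsymbol A$ an algebra and $F\subseteq A$. A model of $\vdash$ is a matrix $\langle \boldsymbol A,F\rangle$ with $\boldsymbol A$ an $\mathcal L_\vdash$-algebra such that, whenever $\Gamma\vdash\varphi$ and $h$ is a homomorphism from the formula algebra of $\vdash$ to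 $\boldsymbol A$ with $h[\Gamma]\subseteq F$, then $h(\varphi)\in F$; in this case $F$ is called a deductive filter of $\vdash$ on $\boldsymbol A$. A congruence $\theta$ is compatible with $F$ if $a\in F$ and $\langle a,b\rangle\in\theta$ imply $b\in F$; the Leibniz congruence $\boldsymbol\Omega^{\boldsymbol A}F$ is the largest congruence of $\boldsymbol A$ compatible with $F$. The Suszko congruence $\widetilde{\boldsymbol\Omega}{}^{\boldsymbol A}_{\vdash}F$ is the intersection of all $\boldsymbol\Omega^{\boldsymbol A}G$, where $G\supseteq F$ is a deductive filter of $\vdash$ on $\boldsymbol A$. $\mathsf{Mod}^{\equiv}(\vdash)$ is the class of models $\langle\boldsymbol A,F\rangle$ of $\vdash$ such that $\widetilde{\boldsymbol\Omega}{}^{\boldsymbol A}_{\vdash}F$ is the identity relation. Interpretability. A translation $\boldsymbol\tau$ of $\mathcal L$ into $\mathcal L'$ maps each $n$-ary symbol $\ast\in\mathcal L$ to an $\mathcal L'$-term $\boldsymbol\tau(\ast)(x_1,\dots,x_n)$. For an $\mathcal L'$-algebra $\boldsymbol A$, $\boldsymbol A^{\boldsymbol\tau}$ is the $\mathcal L$-algebra on $A$ in which $\ast$ is interpreted as the term-function $\boldsymbol\tau(\ast)^{\boldsymbol A}$. An interpretation of $\vdash$ into $\vdash'$ is a translation $\boldsymbol\tau$ of $\mathcal L_\vdash$ into $\mathcal L_{\vdash'}$ such that $\langle\boldsymbol A^{\boldsymbol\tau},F\rangle\in\mathsf{Mod}^{\equiv}(\vdash)$ for all $\langle\boldsymbol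 A,F\rangle\in\mathsf{Mod}^{\equiv}(\vdash')$. Write ${\vdash}\leq{\vdash'}$ if there is one. Leibniz classes. A Leibniz condition is a class $\Phi=\{\vdash_{\Phi_\alpha} : \alpha \text{ an ordinal}\}$ of logics such that $\alpha\leq\beta$ implies ${\vdash_{\Phi_\beta}}\leq{\vdash_{\Phi_\alpha}}$; $\mathrm{Log}(\Phi)$ is the class of logics $\vdash$ with ${\vdash_{\Phi_\alpha}}\leq{\vdash}$ for some ordinal $\alpha$. A Leibniz class is a class of logics of the form $\mathrm{Log}(\Phi)$ for some Leibniz condition $\Phi$. Assertional logics form a Leibniz class. A logic $\vdash$ is assertional if $F$ is a singleton for every $\langle\boldsymbol A,F\rangle\in\mathsf{Mod}^{\equiv}(\vdash)$. *)

theory Defs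
  imports Main
begin

unbundle cardinal_syntax

text \<open>
  The universe of sets. The informal theory speaks of all logics, all algebras and all
  ordinals, which are proper classes. Here the type \<open>'u\<close> plays the role of the universe: a set
  is a subset of \<open>'u\<close> of cardinality less than that of \<open>'u\<close> (a small set), and a class of logics
  is an arbitrary set of logics. The ordinals of the universe are the elements of \<open>'u\<close>, ordered
  by the cardinal well-order \<open>|UNIV|\<close>: each element stands for the order type of its proper
  initial segment, and these are exactly the ordinals below the cardinality of \<open>'u\<close>. When that
  cardinality is strongly inaccessible, this is the usual reading of set-theoretic mathematics
  in a Grothendieck universe. No assumption on the size of \<open>'u\<close> is made, so results are
  stated for every universe, inaccessible ones included.
\<close>

definition small :: "'u set \<Rightarrow> bool" where
  "small X \<longleftrightarrow> |X| <o |UNIV :: 'u set|"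

abbreviation ord_le :: "'u \<Rightarrow> 'u \<Rightarrow> bool" where
  "ord_le \<alpha> \<beta> \<equiv> (\<alpha>, \<beta>) \<in> |UNIV :: 'u set|"

definition ords_below :: "'u \<Rightarrow> 'u set" where
  "ords_below \<kappa> = underS |UNIV :: 'u set| \<kappa>"

definition infinite_cardinal :: "'u \<Rightarrow> bool" where
  "infinite_cardinal \<kappa> \<longleftrightarrow>
     infinite (ords_below \<kappa>) \<and>
     card_order_on (ords_below \<kappa>) (Restr |UNIV :: 'u set| (ords_below \<kappa>))"


section \<open>Languages, terms and algebras\<close>

text \<open>A language assigns to each of its symbols its arity; its symbols are the elements of the
  domain of the map. Constants are rendered by unary symbols.\<close>

type_synonym 'f language = "'f \<rightharpoonup> nat"

definition is_language :: "'f language \<Rightarrow> bool" where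
  "is_language L \<longleftrightarrow> (\<forall>f n. L f = Some n \<longrightarrow> 0 < n)"

datatype ('f, 'v) trm = Var 'v | Fn 'f "('f, 'v) trm list"

inductive_set terms :: "'f language \<Rightarrow> 'v set \<Rightarrow> ('f, 'v) trm set"
  for L :: "'f language" and V :: "'v set" where
  Var: "x \<in> V \<Longrightarrow> Var x \<in> terms L V"
| Fn: "L f = Some (length ts) \<Longrightarrow> \<forall>t \<in> set ts. t \<in> terms L V \<Longrightarrow> Fn f ts \<in> terms L V"

record ('f, 'a) algebra =
  carr :: "'a set"
  opn :: "'f \<Rightarrow> 'a list \<Rightarrow> 'a"

definition is_algebra :: "'f language \<Rightarrow> ('f, 'a) algebra \<Rightarrow> bool" where
  "is_algebra L A \<longleftrightarrow>
     carr A \<noteq> {} \<and>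
     (\<forall>f as. L f = Some (length as) \<longrightarrow> set as \<subseteq> carr A \<longrightarrow> opn A f as \<in> carr A)"

definition Fm :: "'f language \<Rightarrow> 'v set \<Rightarrow> ('f, ('f, 'v) trm) algebra" where
  "Fm L V = \<lparr>carr = terms L V, opn = Fn\<rparr>"

definition homs :: "'f language \<Rightarrow> ('f, 'a) algebra \<Rightarrow> ('f, 'b) algebra \<Rightarrow> ('a \<Rightarrow> 'b) set" where
  "homs L A B =
     {h. h ` carr A \<subseteq> carr B \<and>
         (\<forall>f as. L f = Some (length as) \<longrightarrow> set as \<subseteq> carr A \<longrightarrow>
            h (opn A f as) = opn B f (map h as))}"

fun eval :: "('f, 'a) algebra \<Rightarrow> ('v \<Rightarrow> 'a) \<Rightarrow> ('f, 'v) trm \<Rightarrow> 'a" where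
  "eval A e (Var x) = e x"
| "eval A e (Fn f ts) = opn A f (map (eval A e) ts)"


section \<open>Logics\<close>

text \<open>The formulas are the terms over the variables \<open>x\<^sub>\<alpha>\<close> with \<open>\<alpha> < \<kappa>\<close>, where \<open>\<kappa>\<close> is \<open>vcard\<close>.\<close>

record 'u logical_system =
  lang :: "'u language"
  vcard :: 'u
  entails :: "('u, 'u) trm set \<Rightarrow> ('u, 'u) trm \<Rightarrow> bool"

abbreviation FmL :: "'u logical_system \<Rightarrow> ('u, ('u, 'u) trm) algebra" where
  "FmL l \<equiv> Fm (lang l) (ords_below (vcard l))"

abbreviation formulas :: "'u logical_system \<Rightarrow> ('u, 'u) trm set" where
  "formulas l \<equiv> carr (FmL l)"

definition consequence_relation :: "'x set \<Rightarrow> ('x set \<Rightarrow> 'x \<Rightarrow> bool) \<Rightarrow> bool" where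
  "consequence_relation X C \<longleftrightarrow>
     (\<forall>\<Gamma> \<phi>. C \<Gamma> \<phi> \<longrightarrow> \<Gamma> \<subseteq> X \<and> \<phi> \<in> X) \<and>
     (\<forall>\<Gamma> \<gamma>. \<Gamma> \<subseteq> X \<longrightarrow> \<gamma> \<in> \<Gamma> \<longrightarrow> C \<Gamma> \<gamma>) \<and>
     (\<forall>\<Gamma> \<Delta> \<phi>. \<Gamma> \<subseteq> X \<longrightarrow> (\<forall>\<delta> \<in> \<Delta>. C \<Gamma> \<delta>) \<longrightarrow> C \<Delta> \<phi> \<longrightarrow> C \<Gamma> \<phi>)"

definition is_logic :: "'u logical_system \<Rightarrow> bool" where
  "is_logic l \<longleftrightarrow>
     is_language (lang l) \<and> small (dom (lang l)) \<and>
     infinite_cardinal (vcard l) \<and>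
     consequence_relation (formulas l) (entails l) \<and>
     (\<forall>\<sigma> \<in> homs (lang l) (FmL l) (FmL l). \<forall>\<Gamma> \<phi>. entails l \<Gamma> \<phi> \<longrightarrow> entails l (\<sigma> ` \<Gamma>) (\<sigma> \<phi>))"

definition has_theorems :: "'u logical_system \<Rightarrow> bool" where
  "has_theorems l \<longleftrightarrow> (\<exists>\<phi>. entails l {} \<phi>)"


section \<open>Matrices, Leibniz and Suszko congruences\<close>

definition deductive_filter ::
  "'u logical_system \<Rightarrow> ('u, 'a) algebra \<Rightarrow> 'a set \<Rightarrow> bool" where
  "deductive_filter l A F \<longleftrightarrow>
     F \<subseteq> carr A \<and>
     (\<forall>\<Gamma> \<phi>. \<forall>h \<in> homs (lang l) (FmL l) A.
        entails l \<Gamma> \<phi> \<longrightarrow> h ` \<Gamma> \<subseteq> F \<longrightarrow> h \<phi> \<in> F)"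

definition congruence :: "'f language \<Rightarrow> ('f, 'a) algebra \<Rightarrow> ('a \<times> 'a) set \<Rightarrow> bool" where
  "congruence L A \<theta> \<longleftrightarrow>
     equiv (carr A) \<theta> \<and>
     (\<forall>f as bs. L f = Some (length as) \<longrightarrow> list_all2 (\<lambda>a b. (a, b) \<in> \<theta>) as bs \<longrightarrow>
        (opn A f as, opn A f bs) \<in> \<theta>)"

definition compatible :: "('a \<times> 'a) set \<Rightarrow> 'a set \<Rightarrow> bool" where
  "compatible \<theta> F \<longleftrightarrow> (\<forall>a b. a \<in> F \<longrightarrow> (a, b) \<in> \<theta> \<longrightarrow> b \<in> F)"

definition leibniz :: "'f language \<Rightarrow> ('f, 'a) algebra \<Rightarrow> 'a set \<Rightarrow> ('a \<times> 'a) set" where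
  "leibniz L A F = (GREATEST \<theta>. congruence L A \<theta> \<and> compatible \<theta> F)"

definition suszko :: "'u logical_system \<Rightarrow> ('u, 'a) algebra \<Rightarrow> 'a set \<Rightarrow> ('a \<times> 'a) set" where
  "suszko l A F = \<Inter> {leibniz (lang l) A G | G. deductive_filter l A G \<and> F \<subseteq> G}"

definition Mod_Suszko :: "'u logical_system \<Rightarrow> (('u, 'u) algebra \<times> 'u set) set" where
  "Mod_Suszko l =
     {(A, F). is_algebra (lang l) A \<and> small (carr A) \<and>
        deductive_filter l A F \<and> suszko l A F = Id_on (carr A)}"

definition assertional :: "'u logical_system \<Rightarrow> bool" where
  "assertional l \<longleftrightarrow> (\<forall>(A, F) \<in> Mod_Suszko l. is_singleton F)"

text \<open>Well-definedness of \<^const>\<open>leibniz\<close>: the largest compatible congruence exists.\<close>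

lemma leibniz_greatest:
  assumes A: "is_algebra L A"
  shows "congruence L A (leibniz L A F) \<and> compatible (leibniz L A F) F \<and>
    (\<forall>\<theta>. congruence L A \<theta> \<and> compatible \<theta> F \<longrightarrow> \<theta> \<subseteq> leibniz L A F)"
proof -
  let ?P = "\<lambda>\<theta>. congruence L A \<theta> \<and> compatible \<theta> F"
  define U where "U = \<Union> (Collect ?P)"
  have IdP: "?P (Id_on (carr A))"
  proof -
    have "as = bs \<and> set as \<subseteq> carr A"
      if "list_all2 (\<lambda>a b. (a, b) \<in> Id_on (carr A)) as bs" for as bs
      using that by (induction rule: list_all2_induct) auto
    then show ?thesis
      using A unfolding congruence_def compatible_def is_algebra_def
      by (auto simp: equiv_def refl_on_def sym_def trans_def Id_on_iff)
  qed
  have U_sub: "U \<subseteq> carr A \<times> carr A"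
    unfolding U_def congruence_def equiv_def by blast
  have U_sym: "sym U"
    unfolding U_def congruence_def equiv_def sym_def by blast
  have U_comp: "compatible U F"
    unfolding U_def compatible_def by blast
  have U_refl: "(a, a) \<in> U" if "a \<in> carr A" for a
    using IdP that unfolding U_def by blast
  have T_sub: "U\<^sup>+ \<subseteq> carr A \<times> carr A"
    using U_sub by (rule trancl_subset_Sigma)
  have T_comp: "compatible (U\<^sup>+) F"
  proof -
    have "b \<in> F" if "(a, b) \<in> U\<^sup>+" "a \<in> F" for a b
      using that U_comp unfolding compatible_def by (induction rule: trancl_induct) blast+
    then show ?thesis unfolding compatible_def by blast
  qed
  have T_equiv: "equiv (carr A) (U\<^sup>+)"
    using T_sub U_refl sym_trancl[OF U_sym] trans_trancl[of U]
    by (auto intro!: equivI r_into_trancl simp: refl_on_def)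
  have step: "(opn A f (xs @ a # ys), opn A f (xs @ b # ys)) \<in> U\<^sup>+"
    if "(a, b) \<in> U\<^sup>+" "L f = Some (Suc (length xs + length ys))"
      "set xs \<subseteq> carr A" "set ys \<subseteq> carr A" for f xs ys a b
  proof -
    have one: "(opn A f (xs @ c # ys), opn A f (xs @ d # ys)) \<in> U" if cd: "(c, d) \<in> U" for c d
    proof -
      obtain \<theta> where \<theta>: "?P \<theta>" "(c, d) \<in> \<theta>" using cd unfolding U_def by blast
      have r: "\<forall>x \<in> carr A. (x, x) \<in> \<theta>"
        using \<theta> unfolding congruence_def equiv_def refl_on_def by blast
      have "list_all2 (\<lambda>a b. (a, b) \<in> \<theta>) (xs @ c # ys) (xs @ d # ys)"
        using r \<theta>(2) that(1) \<open>set xs \<subseteq> carr A\<close> \<open>set ys \<subseteq> carr A\<close>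
        by (auto intro!: list_all2_appendI list.rel_refl_strong)
      then have "(opn A f (xs @ c # ys), opn A f (xs @ d # ys)) \<in> \<theta>"
        using \<theta>(1) \<open>L f = _\<close> unfolding congruence_def by simp
      then show ?thesis using \<theta>(1) unfolding U_def by blast
    qed
    show ?thesis
      using that(1) by (induction rule: trancl_induct) (auto dest: one intro: trancl_into_trancl)
  qed
  have many: "(opn A f (xs @ as), opn A f (xs @ bs)) \<in> U\<^sup>+"
    if "list_all2 (\<lambda>a b. (a, b) \<in> U\<^sup>+) as bs" "L f = Some (length xs + length as)"
      "set xs \<subseteq> carr A" for f xs as bs
    using that
  proof (induction arbitrary: xs rule: list_all2_induct)
    case Nil
    then have "opn A f xs \<in> carr A" using A unfolding is_algebra_def by simp
    then show ?case using U_refl by auto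
  next
    case (Cons a as b bs)
    have ab: "a \<in> carr A" "b \<in> carr A" using Cons.hyps T_sub by auto
    have len: "length as = length bs" using Cons.hyps by (auto dest: list_all2_lengthD)
    have as: "set as \<subseteq> carr A"
      using \<open>list_all2 _ as bs\<close> T_sub by (induction rule: list_all2_induct) auto
    have "(opn A f (xs @ a # as), opn A f (xs @ b # as)) \<in> U\<^sup>+"
      using Cons as by (intro step) auto
    moreover have "(opn A f ((xs @ [b]) @ as), opn A f ((xs @ [b]) @ bs)) \<in> U\<^sup>+"
      using Cons.prems ab by (intro Cons.IH) auto
    ultimately show ?case by (auto intro: trancl_trans)
  qed
  have T: "?P (U\<^sup>+)"
    using T_equiv T_comp many[of _ _ _ "[]"] unfolding congruence_def by simp
  have max: "\<theta> \<subseteq> U\<^sup>+" if "?P \<theta>" for \<theta>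
    using that unfolding U_def by (auto intro!: r_into_trancl)
  have "leibniz L A F = U\<^sup>+"
    unfolding leibniz_def using T max by (intro Greatest_equality) auto
  then show ?thesis using T max by auto
qed


section \<open>Interpretations and Leibniz classes\<close>

text \<open>The variables \<open>x\<^sub>1, \<dots>, x\<^sub>n\<close> of the term assigned to an \<open>n\<close>-ary symbol are numbered from 0.\<close>

definition translation :: "'f language \<Rightarrow> 'g language \<Rightarrow> ('f \<Rightarrow> ('g, nat) trm) \<Rightarrow> bool" where
  "translation L L' \<tau> \<longleftrightarrow> (\<forall>f n. L f = Some n \<longrightarrow> \<tau> f \<in> terms L' {..<n})"

definition reduct :: "('f \<Rightarrow> ('g, nat) trm) \<Rightarrow> ('g, 'a) algebra \<Rightarrow> ('f, 'a) algebra" where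
  "reduct \<tau> A = \<lparr>carr = carr A, opn = (\<lambda>f as. eval A (\<lambda>i. as ! i) (\<tau> f))\<rparr>"

definition interpretation_of ::
  "('u \<Rightarrow> ('u, nat) trm) \<Rightarrow> 'u logical_system \<Rightarrow> 'u logical_system \<Rightarrow> bool" where
  "interpretation_of \<tau> l l' \<longleftrightarrow>
     translation (lang l) (lang l') \<tau> \<and>
     (\<forall>(A, F) \<in> Mod_Suszko l'. (reduct \<tau> A, F) \<in> Mod_Suszko l)"

definition interpretable :: "'u logical_system \<Rightarrow> 'u logical_system \<Rightarrow> bool" where
  "interpretable l l' \<longleftrightarrow> (\<exists>\<tau>. interpretation_of \<tau> l l')"

text \<open>A Leibniz condition is a family of logics indexed by the ordinals of the universe.\<close>

definition leibniz_condition :: "('u \<Rightarrow> 'u logical_system) \<Rightarrow> bool" where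
  "leibniz_condition \<Phi> \<longleftrightarrow>
     (\<forall>\<alpha>. is_logic (\<Phi> \<alpha>)) \<and> (\<forall>\<alpha> \<beta>. ord_le \<alpha> \<beta> \<longrightarrow> interpretable (\<Phi> \<beta>) (\<Phi> \<alpha>))"

definition Log :: "('u \<Rightarrow> 'u logical_system) \<Rightarrow> 'u logical_system set" where
  "Log \<Phi> = {l. is_logic l \<and> (\<exists>\<alpha>. interpretable (\<Phi> \<alpha>) l)}"

definition leibniz_class :: "'u logical_system set \<Rightarrow> bool" where
  "leibniz_class K \<longleftrightarrow> (\<exists>\<Phi>. leibniz_condition \<Phi> \<and> K = Log \<Phi>)"

end

theory Submission
  imports Defs
begin

text \<open>
  Suppose that both classes contain a logic that is not assertional. A member of a Leibniz class lies
  above some logic of the underlying Leibniz condition, and a model in which it violates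
  assertionality is, after a change of language, such a model of the logic below. This gives logics
  \<open>l1\<close> and \<open>l2\<close> from the two Leibniz conditions with Suszko-reduced matrices whose filters have
  at least two elements and are proper (\<open>non_assertional_model\<close>; theorems exclude the empty filter).
  It suffices to find a logic, not assertional, in which both \<open>l1\<close> and \<open>l2\<close> are interpretable, since
  it belongs to both classes.

  The two matrices can be assumed to have the same carrier and the same filter: almost constant
  functions over a large enough index set form a subdirect power in which the filter and its
  complement both have the cardinality of the index set (\<open>Mod_Suszko_resize\<close>), so the two powers
  can be identified along a bijection that respects the filters. Now there is one set \<open>A\<close> with a
  filter \<open>F\<close> and the operations of both logics.

  The logic of this matrix is not yet good enough: a translation is an interpretation only if the
  reducts of all reduced models are Suszko-reduced, and models may be far from \<open>A\<close>. Therefore \<open>A\<close>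
  is enriched by names for its elements, by an operation that expresses equality of two elements
  under a condition that is itself a pair of equalities, and by tests for enough
  \<open>l1\<close>- and \<open>l2\<close>-filters to separate the elements of \<open>A\<close>. In any reduced model of the enriched
  logic, two distinct elements \<open>y\<close>, \<open>z\<close> can be assigned distinct named elements \<open>a\<close>, \<open>b\<close> such that the
  condition \<open>y = a\<close>, \<open>z = b\<close> is not refuted (\<open>separated_by_elements\<close>). Relative to this condition
  a filter on \<open>A\<close> that separates \<open>a\<close> from \<open>b\<close> is pulled back to a filter on the model, and it
  separates \<open>y\<close> from \<open>z\<close> (\<open>suszko_reduct_trivial\<close>). So the reducts are Suszko-reduced, both
  logics are interpretable (\<open>common_upper_bound\<close>), and \<open>A\<close> itself shows that the enriched logic is
  not assertional.

  Every construction stays within the size of the given carriers, languages and sets of variables: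
  only finitely many changes are made to constant functions, and only one filter is tested for each
  pair of elements. So all sets that occur are small, whatever the size of the universe.
\<close>


section \<open>Evaluation of terms and homomorphisms\<close>

lemma Var_in_terms_iff [simp]: "Var x \<in> terms L V \<longleftrightarrow> x \<in> V"
  by (auto intro: terms.Var elim: terms.cases)

lemma Fn_in_terms_iff [simp]:
  "Fn s ts \<in> terms L V \<longleftrightarrow> L s = Some (length ts) \<and> set ts \<subseteq> terms L V"
  by (auto intro: terms.Fn elim: terms.cases)

lemma carr_Fm [simp]: "carr (Fm L V) = terms L V"
  and opn_Fm [simp]: "opn (Fm L V) = Fn"
  and carr_reduct [simp]: "carr (reduct \<tau> A) = carr A"
  and opn_reduct: "opn (reduct \<tau> A) s as = eval A (\<lambda>i. as ! i) (\<tau> s)"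
  by (simp_all add: Fm_def reduct_def)

lemma is_algebraD:
  "is_algebra L A \<Longrightarrow> L s = Some (length as) \<Longrightarrow> set as \<subseteq> carr A \<Longrightarrow> opn A s as \<in> carr A"
  unfolding is_algebra_def by blast

lemma homs_carr: "h \<in> homs L A B \<Longrightarrow> a \<in> carr A \<Longrightarrow> h a \<in> carr B"
  unfolding homs_def by blast

lemma homs_opn:
  "h \<in> homs L A B \<Longrightarrow> L s = Some (length as) \<Longrightarrow> set as \<subseteq> carr A \<Longrightarrow>
    h (opn A s as) = opn B s (map h as)"
  unfolding homs_def by blast

lemma eval_closed:
  assumes "is_algebra L A" "t \<in> terms L V" "e ` V \<subseteq> carr A"
  shows "eval A e t \<in> carr A"
  using assms(2)
proof induction
  case (Var x)
  then show ?case using assms(3) by auto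
next
  case (Fn s ts)
  then show ?case using assms(1) by (auto intro!: is_algebraD)
qed

lemma eval_cong:
  assumes "t \<in> terms L V" "\<And>x. x \<in> V \<Longrightarrow> e x = e' x"
  shows "eval A e t = eval A e' t"
  using assms(1)
proof induction
  case (Var x)
  then show ?case using assms(2) by simp
next
  case (Fn s ts)
  then have "map (eval A e) ts = map (eval A e') ts" by simp
  then show ?case by (simp only: eval.simps)
qed

lemma hom_eval:
  assumes "h \<in> homs L A B" "is_algebra L A" "e ` V \<subseteq> carr A" "t \<in> terms L V"
  shows "h (eval A e t) = eval B (\<lambda>x. h (e x)) t"
  using assms(4)
proof induction
  case (Var x)
  then show ?case by simp
next
  case (Fn s ts)
  have sub: "set (map (eval A e) ts) \<subseteq> carr A"
    using Fn eval_closed[OF assms(2) _ assms(3)] by auto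
  have eq: "map h (map (eval A e) ts) = map (eval B (\<lambda>x. h (e x))) ts"
    using Fn by auto
  show ?case
    using homs_opn[OF assms(1) _ sub, of s] Fn.hyps unfolding eq by simp
qed

lemma eval_in_homs:
  assumes "is_algebra L A" "e ` V \<subseteq> carr A"
  shows "eval A e \<in> homs L (Fm L V) A"
  using eval_closed[OF assms(1) _ assms(2)] unfolding homs_def by auto

lemma is_algebra_Fm:
  assumes "V \<noteq> {}"
  shows "is_algebra L (Fm L V)"
proof -
  obtain x where "x \<in> V" using assms by blast
  then have "Var x \<in> terms L V" by simp
  then have "terms L V \<noteq> {}" by blast
  then show ?thesis unfolding is_algebra_def by auto
qed

lemma hom_Fm_eq_eval:
  assumes "h \<in> homs L (Fm L V) A" "t \<in> terms L V"
  shows "h t = eval A (\<lambda>x. h (Var x)) t"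
  using assms(2)
proof induction
  case (Var x)
  then show ?case by simp
next
  case (Fn s ts)
  have eq: "map h ts = map (eval A (\<lambda>x. h (Var x))) ts"
    using Fn by auto
  have "set ts \<subseteq> carr (Fm L V)" using Fn by auto
  from homs_opn[OF assms(1) Fn.hyps this] show ?case unfolding eq by simp
qed


section \<open>Reducts\<close>

lemma nth_image_lessThan: "set as \<subseteq> X \<Longrightarrow> (\<lambda>i. as ! i) ` {..<length as} \<subseteq> X"
  by auto

lemma is_algebra_reduct:
  assumes A: "is_algebra L' A" and \<tau>: "translation L L' \<tau>"
  shows "is_algebra L (reduct \<tau> A)"
proof -
  have "opn (reduct \<tau> A) s as \<in> carr A"
    if s: "L s = Some (length as)" and as: "set as \<subseteq> carr A" for s as
  proof -
    have "\<tau> s \<in> terms L' {..<length as}" using \<tau> s unfolding translation_def by blast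
    from eval_closed[OF A this nth_image_lessThan[OF as]] show ?thesis by (simp add: opn_reduct)
  qed
  then show ?thesis using A unfolding is_algebra_def by simp
qed

lemma homs_reduct:
  assumes h: "h \<in> homs L' A B" and A: "is_algebra L' A" and \<tau>: "translation L L' \<tau>"
  shows "h \<in> homs L (reduct \<tau> A) (reduct \<tau> B)"
proof -
  have "h (opn (reduct \<tau> A) s as) = opn (reduct \<tau> B) s (map h as)"
    if s: "L s = Some (length as)" and as: "set as \<subseteq> carr A" for s as
  proof -
    have t: "\<tau> s \<in> terms L' {..<length as}" using \<tau> s unfolding translation_def by blast
    have "h (eval A (\<lambda>i. as ! i) (\<tau> s)) = eval B (\<lambda>i. h (as ! i)) (\<tau> s)"
      by (rule hom_eval[OF h A nth_image_lessThan[OF as] t])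
    also have "\<dots> = eval B (\<lambda>i. map h as ! i) (\<tau> s)"
      by (rule eval_cong[OF t]) simp
    finally show ?thesis by (simp add: opn_reduct)
  qed
  then show ?thesis using h unfolding homs_def by auto
qed

lemma congruence_refl: "congruence L A \<theta> \<Longrightarrow> a \<in> carr A \<Longrightarrow> (a, a) \<in> \<theta>"
  unfolding congruence_def equiv_def refl_on_def by blast

lemma congruence_carr: "congruence L A \<theta> \<Longrightarrow> (a, b) \<in> \<theta> \<Longrightarrow> a \<in> carr A \<and> b \<in> carr A"
  unfolding congruence_def equiv_def by blast

lemma congruence_sym: "congruence L A \<theta> \<Longrightarrow> (a, b) \<in> \<theta> \<Longrightarrow> (b, a) \<in> \<theta>"
  unfolding congruence_def equiv_def sym_def by blast

lemma congruence_trans: "congruence L A \<theta> \<Longrightarrow> (a, b) \<in> \<theta> \<Longrightarrow> (b, c) \<in> \<theta> \<Longrightarrow> (a, c) \<in> \<theta>"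
  unfolding congruence_def equiv_def trans_def by blast

lemma congruence_opn:
  "congruence L A \<theta> \<Longrightarrow> L s = Some (length as) \<Longrightarrow> list_all2 (\<lambda>a b. (a, b) \<in> \<theta>) as bs \<Longrightarrow>
    (opn A s as, opn A s bs) \<in> \<theta>"
  unfolding congruence_def by blast

lemma congruenceI:
  assumes "\<theta> \<subseteq> carr A \<times> carr A"
    and "\<And>a. a \<in> carr A \<Longrightarrow> (a, a) \<in> \<theta>"
    and "\<And>a b. (a, b) \<in> \<theta> \<Longrightarrow> (b, a) \<in> \<theta>"
    and "\<And>a b c. (a, b) \<in> \<theta> \<Longrightarrow> (b, c) \<in> \<theta> \<Longrightarrow> (a, c) \<in> \<theta>"
    and "\<And>s as bs. L s = Some (length as) \<Longrightarrow> list_all2 (\<lambda>a b. (a, b) \<in> \<theta>) as bs \<Longrightarrow>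
      (opn A s as, opn A s bs) \<in> \<theta>"
  shows "congruence L A \<theta>"
proof -
  have "refl_on (carr A) \<theta>" using assms(1,2) unfolding refl_on_def by blast
  moreover have "sym \<theta>" using assms(3) by (rule symI)
  moreover have "trans \<theta>" using assms(4) by (rule transI)
  ultimately show ?thesis
    using assms(1,5) unfolding congruence_def by (auto intro: equivI)
qed

lemma congruence_list_carr:
  assumes "congruence L A \<theta>" "list_all2 (\<lambda>a b. (a, b) \<in> \<theta>) as bs"
  shows "set as \<subseteq> carr A" "set bs \<subseteq> carr A"
  using assms(2) congruence_carr[OF assms(1)]
  by (induction rule: list_all2_induct) auto

lemma congruence_eval:
  assumes "congruence L A \<theta>" "t \<in> terms L V" "\<And>x. x \<in> V \<Longrightarrow> (e x, e' x) \<in> \<theta>"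
  shows "(eval A e t, eval A e' t) \<in> \<theta>"
  using assms(2)
proof induction
  case (Var x)
  then show ?case using assms(3) by simp
next
  case (Fn s ts)
  then have "list_all2 (\<lambda>a b. (a, b) \<in> \<theta>) (map (eval A e) ts) (map (eval A e') ts)"
    by (auto simp: list_all2_conv_all_nth)
  then show ?case using congruence_opn[OF assms(1)] Fn by simp
qed

lemma congruence_reduct:
  assumes \<theta>: "congruence L' A \<theta>" and \<tau>: "translation L L' \<tau>"
  shows "congruence L (reduct \<tau> A) \<theta>"
proof -
  have "(opn (reduct \<tau> A) s as, opn (reduct \<tau> A) s bs) \<in> \<theta>"
    if s: "L s = Some (length as)" and ab: "list_all2 (\<lambda>a b. (a, b) \<in> \<theta>) as bs" for s as bs
  proof -
    have t: "\<tau> s \<in> terms L' {..<length as}" using \<tau> s unfolding translation_def by blast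
    show ?thesis
      unfolding opn_reduct using ab
      by (intro congruence_eval[OF \<theta> t]) (auto simp: list_all2_conv_all_nth)
  qed
  then show ?thesis using \<theta> unfolding congruence_def by simp
qed


section \<open>Deductive filters and Leibniz congruences under homomorphisms\<close>

lemma is_logic_entails_formulas:
  assumes "is_logic l" "entails l \<Gamma> \<phi>"
  shows "\<Gamma> \<subseteq> terms (lang l) (ords_below (vcard l))" "\<phi> \<in> terms (lang l) (ords_below (vcard l))"
proof -
  have "consequence_relation (formulas l) (entails l)" using assms(1) unfolding is_logic_def by (elim conjE)
  then have "\<forall>\<Gamma> \<phi>. entails l \<Gamma> \<phi> \<longrightarrow> \<Gamma> \<subseteq> formulas l \<and> \<phi> \<in> formulas l"
    unfolding consequence_relation_def by (elim conjE)
  with assms(2) have "\<Gamma> \<subseteq> formulas l \<and> \<phi> \<in> formulas l" by blast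
  then show "\<Gamma> \<subseteq> terms (lang l) (ords_below (vcard l))" "\<phi> \<in> terms (lang l) (ords_below (vcard l))"
    by simp_all
qed

lemma deductive_filter_subset: "deductive_filter l A F \<Longrightarrow> F \<subseteq> carr A"
  unfolding deductive_filter_def by blast

lemma deductive_filter_eval:
  assumes "deductive_filter l A F" "is_algebra (lang l) A" "entails l \<Gamma> \<phi>"
    "e ` ords_below (vcard l) \<subseteq> carr A" "\<And>\<gamma>. \<gamma> \<in> \<Gamma> \<Longrightarrow> eval A e \<gamma> \<in> F"
  shows "eval A e \<phi> \<in> F"
proof -
  have "eval A e \<in> homs (lang l) (FmL l) A" by (rule eval_in_homs[OF assms(2,4)])
  moreover have "eval A e ` \<Gamma> \<subseteq> F" using assms(5) by blast
  ultimately show ?thesis using assms(1,3) unfolding deductive_filter_def by blast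
qed

lemma deductive_filterI:
  assumes l: "is_logic l" and "F \<subseteq> carr A"
    and closed: "\<And>\<Gamma> \<phi> e. entails l \<Gamma> \<phi> \<Longrightarrow> e ` ords_below (vcard l) \<subseteq> carr A \<Longrightarrow>
      (\<And>\<gamma>. \<gamma> \<in> \<Gamma> \<Longrightarrow> eval A e \<gamma> \<in> F) \<Longrightarrow> eval A e \<phi> \<in> F"
  shows "deductive_filter l A F"
proof -
  let ?V = "ords_below (vcard l)"
  have "h \<phi> \<in> F" if h: "h \<in> homs (lang l) (FmL l) A" and ent: "entails l \<Gamma> \<phi>" and \<Gamma>: "h ` \<Gamma> \<subseteq> F"
    for \<Gamma> \<phi> h
  proof -
    note fm = is_logic_entails_formulas[OF l ent]
    define e where "e = (\<lambda>x. h (Var x))"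
    have eq: "eval A e \<psi> = h \<psi>" if "\<psi> \<in> terms (lang l) ?V" for \<psi>
      using hom_Fm_eq_eval[OF h that] unfolding e_def by simp
    have "e ` ?V \<subseteq> carr A" using homs_carr[OF h] unfolding e_def by auto
    moreover have "eval A e \<gamma> \<in> F" if "\<gamma> \<in> \<Gamma>" for \<gamma>
      using eq[of \<gamma>] fm(1) \<Gamma> that by auto
    ultimately have "eval A e \<phi> \<in> F" using closed[OF ent] by blast
    then show ?thesis using eq fm(2) by simp
  qed
  then show ?thesis using assms(2) unfolding deductive_filter_def by blast
qed

lemma deductive_filter_carr:
  assumes l: "is_logic l" and A: "is_algebra (lang l) A"
  shows "deductive_filter l A (carr A)"
proof (rule deductive_filterI[OF l])
  show "eval A e \<phi> \<in> carr A" if "entails l \<Gamma> \<phi>" "e ` ords_below (vcard l) \<subseteq> carr A" for \<Gamma> \<phi> e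
    by (rule eval_closed[OF A is_logic_entails_formulas(2)[OF l that(1)] that(2)])
qed simp

lemma deductive_filter_vimage:
  assumes l: "is_logic l" and A: "is_algebra (lang l) A" and B: "is_algebra (lang l) B"
    and h: "h \<in> homs (lang l) A B" and G: "deductive_filter l B G"
  shows "deductive_filter l A {a \<in> carr A. h a \<in> G}"
proof (rule deductive_filterI[OF l])
  fix \<Gamma> \<phi> e
  assume ent: "entails l \<Gamma> \<phi>" and e: "e ` ords_below (vcard l) \<subseteq> carr A"
    and prem: "\<And>\<gamma>. \<gamma> \<in> \<Gamma> \<Longrightarrow> eval A e \<gamma> \<in> {a \<in> carr A. h a \<in> G}"
  note fm = is_logic_entails_formulas[OF l ent]
  have "eval B (\<lambda>x. h (e x)) \<phi> \<in> G"
  proof (rule deductive_filter_eval[OF G B ent])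
    show "(\<lambda>x. h (e x)) ` ords_below (vcard l) \<subseteq> carr B" using e homs_carr[OF h] by auto
    show "eval B (\<lambda>x. h (e x)) \<gamma> \<in> G" if "\<gamma> \<in> \<Gamma>" for \<gamma>
      using prem[OF that] hom_eval[OF h A e, of \<gamma>] fm that by auto
  qed
  then show "eval A e \<phi> \<in> {a \<in> carr A. h a \<in> G}"
    using hom_eval[OF h A e fm(2)] eval_closed[OF A fm(2) e] by simp
qed auto

lemma leibniz_congruence: "is_algebra L A \<Longrightarrow> congruence L A (leibniz L A F)"
  and leibniz_compatible: "is_algebra L A \<Longrightarrow> compatible (leibniz L A F) F"
  and leibniz_maximal:
    "is_algebra L A \<Longrightarrow> congruence L A \<theta> \<Longrightarrow> compatible \<theta> F \<Longrightarrow> \<theta> \<subseteq> leibniz L A F"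
  using leibniz_greatest[of L A F] by blast+

lemma congruence_vimage:
  assumes h: "h \<in> homs L A B" and A: "is_algebra L A" and \<theta>: "congruence L B \<theta>"
  shows "congruence L A {(a, b). a \<in> carr A \<and> b \<in> carr A \<and> (h a, h b) \<in> \<theta>}" (is "congruence L A ?\<psi>")
proof (rule congruenceI)
  fix s as bs
  assume s: "L s = Some (length as)" and ab: "list_all2 (\<lambda>a b. (a, b) \<in> ?\<psi>) as bs"
  then have len: "length bs = length as" by (auto dest: list_all2_lengthD)
  have as: "set as \<subseteq> carr A" "set bs \<subseteq> carr A"
    using ab by (induction rule: list_all2_induct) auto
  have "list_all2 (\<lambda>a b. (a, b) \<in> \<theta>) (map h as) (map h bs)"
    using ab by (auto simp: list_all2_conv_all_nth)
  then have "(opn B s (map h as), opn B s (map h bs)) \<in> \<theta>"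
    using congruence_opn[OF \<theta>] s by simp
  then show "(opn A s as, opn A s bs) \<in> ?\<psi>"
    using homs_opn[OF h] s as len is_algebraD[OF A] by simp
next
  show "(a, c) \<in> ?\<psi>" if "(a, b) \<in> ?\<psi>" "(b, c) \<in> ?\<psi>" for a b c
    using that congruence_trans[OF \<theta>, of "h a" "h b" "h c"] by simp
qed (auto intro: congruence_refl[OF \<theta>] congruence_sym[OF \<theta>] homs_carr[OF h])

text \<open>
  A surjective homomorphism carries the Leibniz congruence of the inverse image of \<open>G\<close> into that
  of \<open>G\<close>: the kernel is compatible with the inverse image, so the Leibniz congruence there
  contains the kernel, and this is what makes its direct image transitive.
\<close>

lemma leibniz_vimage_surj:
  assumes A: "is_algebra L A" and B: "is_algebra L B"
    and h: "h \<in> homs L A B" and surj: "h ` carr A = carr B"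
    and ab: "(a, b) \<in> leibniz L A {a \<in> carr A. h a \<in> G}"
  shows "(h a, h b) \<in> leibniz L B G"
proof -
  let ?F = "{a \<in> carr A. h a \<in> G}"
  let ?\<theta> = "leibniz L A ?F"
  let ?K = "{(a, b). a \<in> carr A \<and> b \<in> carr A \<and> (h a, h b) \<in> Id_on (carr B)}"
  let ?\<psi> = "{(h a, h b) | a b. (a, b) \<in> ?\<theta>}"
  note \<theta> = leibniz_congruence[OF A, of ?F]
  have eq: "as = bs \<and> set as \<subseteq> carr B"
    if "list_all2 (\<lambda>a b. (a, b) \<in> Id_on (carr B)) as bs" for as bs
    using that by (induction rule: list_all2_induct) auto
  have "congruence L B (Id_on (carr B))"
    by (intro congruenceI) (auto dest!: eq intro!: is_algebraD[OF B])
  then have "?K \<subseteq> ?\<theta>"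
    by (intro leibniz_maximal[OF A] congruence_vimage[OF h A]) (auto simp: compatible_def)
  then have ker: "(a, b) \<in> ?\<theta>" if "a \<in> carr A" "b \<in> carr A" "h a = h b" for a b
  proof -
    have "(a, b) \<in> ?K" using that homs_carr[OF h] by (simp add: Id_on_iff)
    with \<open>?K \<subseteq> ?\<theta>\<close> show ?thesis by (rule subsetD)
  qed
  have "congruence L B ?\<psi>"
  proof (rule congruenceI)
    show "?\<psi> \<subseteq> carr B \<times> carr B"
      using congruence_carr[OF \<theta>] homs_carr[OF h] by blast
    show "(x, x) \<in> ?\<psi>" if "x \<in> carr B" for x
      using that surj congruence_refl[OF \<theta>] by blast
    show "(y, x) \<in> ?\<psi>" if "(x, y) \<in> ?\<psi>" for x y
      using that congruence_sym[OF \<theta>] by blast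
    show "(x, z) \<in> ?\<psi>" if "(x, y) \<in> ?\<psi>" "(y, z) \<in> ?\<psi>" for x y z
    proof -
      obtain a b b' c where *: "x = h a" "y = h b" "(a, b) \<in> ?\<theta>" "y = h b'" "z = h c" "(b', c) \<in> ?\<theta>"
        using \<open>(x, y) \<in> ?\<psi>\<close> \<open>(y, z) \<in> ?\<psi>\<close> by auto
      then have "(b, b') \<in> ?\<theta>"
        using ker congruence_carr[OF \<theta>] by metis
      then show ?thesis
        using * congruence_trans[OF \<theta>] by blast
    qed
    show "(opn B s xs, opn B s ys) \<in> ?\<psi>"
      if s: "L s = Some (length xs)" and xy: "list_all2 (\<lambda>x y. (x, y) \<in> ?\<psi>) xs ys" for s xs ys
    proof -
      have "\<exists>as bs. list_all2 (\<lambda>a b. (a, b) \<in> ?\<theta>) as bs \<and> xs = map h as \<and> ys = map h bs"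
        using xy
      proof (induction rule: list_all2_induct)
        case Nil
        then show ?case by simp
      next
        case (Cons x xs y ys)
        then obtain as bs a b where ab: "list_all2 (\<lambda>a b. (a, b) \<in> ?\<theta>) as bs"
          "xs = map h as" "ys = map h bs" "(a, b) \<in> ?\<theta>" "x = h a" "y = h b"
          by blast
        show ?case by (rule exI[of _ "a # as"], rule exI[of _ "b # bs"]) (simp add: ab)
      qed
      then obtain as bs where asbs: "list_all2 (\<lambda>a b. (a, b) \<in> ?\<theta>) as bs"
        "xs = map h as" "ys = map h bs" by blast
      then have "(opn A s as, opn A s bs) \<in> ?\<theta>" using congruence_opn[OF \<theta>] s by simp
      moreover have "opn B s xs = h (opn A s as)" "opn B s ys = h (opn A s bs)"
        using homs_opn[OF h] s asbs congruence_list_carr[OF \<theta> asbs(1)]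
          list_all2_lengthD[OF asbs(1)] by auto
      ultimately show ?thesis by blast
    qed
  qed
  moreover have "compatible ?\<psi> G"
    using leibniz_compatible[OF A, of ?F] congruence_carr[OF \<theta>] unfolding compatible_def by blast
  ultimately have "?\<psi> \<subseteq> leibniz L B G" by (rule leibniz_maximal[OF B])
  then show ?thesis using ab by blast
qed

lemma suszko_leibniz:
  "(a, b) \<in> suszko l A F \<longleftrightarrow>
    (\<forall>G. deductive_filter l A G \<longrightarrow> F \<subseteq> G \<longrightarrow> (a, b) \<in> leibniz (lang l) A G)"
  unfolding suszko_def by auto

lemma Mod_SuszkoI:
  assumes A: "is_algebra (lang l) A" and sm: "small (carr A)" and F: "deductive_filter l A F"
    and eq: "\<And>a b. (a, b) \<in> suszko l A F \<Longrightarrow> a = b"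
  shows "(A, F) \<in> Mod_Suszko l"
proof -
  have "(a, a) \<in> suszko l A F" if "a \<in> carr A" for a
    using congruence_refl[OF leibniz_congruence[OF A] that] unfolding suszko_leibniz by blast
  moreover have "a \<in> carr A" if "(a, b) \<in> suszko l A F" for a b
    using that F congruence_carr[OF leibniz_congruence[OF A]] unfolding suszko_leibniz by blast
  ultimately have "suszko l A F = Id_on (carr A)"
    using eq by (auto simp: Id_on_iff dest: eq)
  then show ?thesis unfolding Mod_Suszko_def using A sm F by simp
qed

lemma Mod_SuszkoD:
  assumes "(A, F) \<in> Mod_Suszko l"
  shows "is_algebra (lang l) A" "small (carr A)" "deductive_filter l A F"
    "(a, b) \<in> suszko l A F \<Longrightarrow> a = b"
  using assms unfolding Mod_Suszko_def by auto

text \<open>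
  Suszko-reduced models are closed under subdirect powers: for each coordinate \<open>i\<close>, the filters
  \<open>H \<supseteq> G\<close> of the factor pull back along \<open>\<pi> i\<close> to filters of the power, and a pair identified by
  the Leibniz congruences of all of these has \<open>i\<close>-th coordinates identified by the Suszko
  congruence of the factor.
\<close>

lemma Mod_Suszko_subdirect:
  assumes l: "is_logic l" and B: "(B, G) \<in> Mod_Suszko l"
    and A: "is_algebra (lang l) A" and sm: "small (carr A)"
    and \<pi>: "\<And>i. \<pi> i \<in> homs (lang l) A B" "\<And>i. \<pi> i ` carr A = carr B"
    and inj: "\<And>a b. a \<in> carr A \<Longrightarrow> b \<in> carr A \<Longrightarrow> (\<And>i. \<pi> i a = \<pi> i b) \<Longrightarrow> a = b"
  shows "(A, {a \<in> carr A. \<forall>i. \<pi> i a \<in> G}) \<in> Mod_Suszko l" (is "(A, ?F) \<in> _")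
proof (rule Mod_SuszkoI[OF A sm])
  note B' = Mod_SuszkoD[OF B]
  have filt: "deductive_filter l A {a \<in> carr A. \<pi> i a \<in> H}" if "deductive_filter l B H" for i H
    by (rule deductive_filter_vimage[OF l A B'(1) \<pi>(1) that])
  show "deductive_filter l A ?F"
  proof (rule deductive_filterI[OF l])
    fix \<Gamma> \<phi> e
    assume ent: "entails l \<Gamma> \<phi>" and e: "e ` ords_below (vcard l) \<subseteq> carr A"
      and prem: "\<And>\<gamma>. \<gamma> \<in> \<Gamma> \<Longrightarrow> eval A e \<gamma> \<in> ?F"
    have "eval A e \<phi> \<in> {a \<in> carr A. \<pi> i a \<in> G}" for i
      by (rule deductive_filter_eval[OF filt[OF B'(3)] A ent e]) (use prem in blast)
    then show "eval A e \<phi> \<in> ?F" by blast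
  qed auto
  fix a b
  assume ab: "(a, b) \<in> suszko l A ?F"
  have "(a, b) \<in> leibniz (lang l) A (carr A)"
    using ab deductive_filter_carr[OF l A] unfolding suszko_leibniz by blast
  then have carr: "a \<in> carr A" "b \<in> carr A"
    using congruence_carr[OF leibniz_congruence[OF A]] by blast+
  have "\<pi> i a = \<pi> i b" for i
  proof (rule B'(4))
    show "(\<pi> i a, \<pi> i b) \<in> suszko l B G"
      unfolding suszko_leibniz
    proof (intro allI impI)
      fix H
      assume H: "deductive_filter l B H" "G \<subseteq> H"
      then have "(a, b) \<in> leibniz (lang l) A {a \<in> carr A. \<pi> i a \<in> H}"
        using ab filt[OF H(1), of i] unfolding suszko_leibniz by blast
      then show "(\<pi> i a, \<pi> i b) \<in> leibniz (lang l) B H"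
        by (rule leibniz_vimage_surj[OF A B'(1) \<pi>])
    qed
  qed
  then show "a = b" by (rule inj[OF carr])
qed

text \<open>
  Operations of a reduct take unintended values on lists of the wrong length, so an algebra is
  recovered as a reduct only up to the values that respect the arities. The following lemmas say
  that homomorphisms, congruences and filters see nothing else.
\<close>

lemma homs_opn_cong:
  assumes carr: "carr A = carr A'"
    and eq: "\<And>s as. L s = Some (length as) \<Longrightarrow> set as \<subseteq> carr A \<Longrightarrow> opn A s as = opn A' s as"
    and h: "h \<in> homs L C A"
  shows "h \<in> homs L C A'"
proof -
  have "h (opn C s as) = opn A' s (map h as)"
    if s: "L s = Some (length as)" and as: "set as \<subseteq> carr C" for s as
  proof -
    have "set (map h as) \<subseteq> carr A" using homs_carr[OF h] as by auto
    then have "opn A s (map h as) = opn A' s (map h as)" using eq s by simp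
    then show ?thesis using homs_opn[OF h s as] by simp
  qed
  moreover have "h ` carr C \<subseteq> carr A'" using homs_carr[OF h] carr by auto
  ultimately show ?thesis unfolding homs_def by simp
qed

lemma congruence_opn_cong:
  assumes "carr A = carr A'"
    and eq: "\<And>s as. L s = Some (length as) \<Longrightarrow> set as \<subseteq> carr A \<Longrightarrow> opn A s as = opn A' s as"
    and \<theta>: "congruence L A \<theta>"
  shows "congruence L A' \<theta>"
proof -
  have "(opn A' s as, opn A' s bs) \<in> \<theta>"
    if s: "L s = Some (length as)" and ab: "list_all2 (\<lambda>a b. (a, b) \<in> \<theta>) as bs" for s as bs
    using congruence_opn[OF \<theta> s ab] eq[of s as] eq[of s bs] s congruence_list_carr[OF \<theta> ab]
      list_all2_lengthD[OF ab] by simp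
  moreover have "equiv (carr A') \<theta>" using \<theta> assms(1) unfolding congruence_def by simp
  ultimately show ?thesis unfolding congruence_def by blast
qed

lemma leibniz_opn_cong:
  assumes "carr A = carr A'"
    and "\<And>s as. L s = Some (length as) \<Longrightarrow> set as \<subseteq> carr A \<Longrightarrow> opn A s as = opn A' s as"
  shows "leibniz L A = leibniz L A'"
proof -
  have "congruence L A \<theta> \<longleftrightarrow> congruence L A' \<theta>" for \<theta>
  proof
    show "congruence L A \<theta> \<Longrightarrow> congruence L A' \<theta>"
      by (rule congruence_opn_cong[OF assms])
    show "congruence L A' \<theta> \<Longrightarrow> congruence L A \<theta>"
      by (rule congruence_opn_cong[of A' A]) (use assms in simp_all)
  qed
  then show ?thesis unfolding leibniz_def by (intro ext) simp
qed

lemma deductive_filter_opn_cong: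
  assumes "carr A = carr A'"
    and "\<And>s as. lang l s = Some (length as) \<Longrightarrow> set as \<subseteq> carr A \<Longrightarrow> opn A s as = opn A' s as"
  shows "deductive_filter l A H \<longleftrightarrow> deductive_filter l A' H"
proof -
  have "homs (lang l) (FmL l) A = homs (lang l) (FmL l) A'"
  proof (intro equalityI subsetI)
    show "h \<in> homs (lang l) (FmL l) A \<Longrightarrow> h \<in> homs (lang l) (FmL l) A'" for h
      by (rule homs_opn_cong[OF assms])
    show "h \<in> homs (lang l) (FmL l) A' \<Longrightarrow> h \<in> homs (lang l) (FmL l) A" for h
      by (rule homs_opn_cong[of A' A]) (use assms in simp_all)
  qed
  then show ?thesis unfolding deductive_filter_def using assms(1) by simp
qed


section \<open>Subdirect powers of prescribed size\<close>

text \<open>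
  The full power of a matrix over an index set \<open>I\<close> may be too large to be a set of the universe. The
  functions that are constant up to finitely many changes inside \<open>I\<close> already form a subdirect power,
  and for infinite \<open>I\<close> there are no more of them than elements of \<open>I\<close>. Indexing by a whole type, with
  changes allowed in \<open>I\<close> only, avoids partial functions.
\<close>

definition almost_constant :: "'i set \<Rightarrow> 'a set \<Rightarrow> ('i \<Rightarrow> 'a) set" where
  "almost_constant I A =
    {x. range x \<subseteq> A \<and> (\<exists>a \<in> A. finite {i. x i \<noteq> a} \<and> {i. x i \<noteq> a} \<subseteq> I)}"

text \<open>
  Counting device: the functions reached from a constant one by \<open>n\<close> single changes. Each stage is
  an image of a product of sets of cardinality at most \<open>|I|\<close>, which bounds the cardinality.
\<close>

primrec updates :: "'i set \<Rightarrow> 'a set \<Rightarrow> nat \<Rightarrow> ('i \<Rightarrow> 'a) set" where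
  "updates I A 0 = (\<lambda>a _. a) ` A"
| "updates I A (Suc n) = (\<lambda>(x, i, a). x(i := a)) ` (updates I A n \<times> I \<times> A)"

lemma almost_constant_updates: "almost_constant I A \<subseteq> (\<Union>n. updates I A n)"
proof
  fix x
  assume "x \<in> almost_constant I A"
  then obtain a where x: "range x \<subseteq> A" and a: "a \<in> A"
    and fin: "finite {i. x i \<noteq> a}" and sub: "{i. x i \<noteq> a} \<subseteq> I"
    unfolding almost_constant_def by auto
  have "\<exists>n. y \<in> updates I A n" if "finite D" "D \<subseteq> I" "range y \<subseteq> A" "{i. y i \<noteq> a} = D" for D y
    using that
  proof (induction D arbitrary: y rule: finite_induct)
    case empty
    then have "y = (\<lambda>_. a)" by auto
    then have "y \<in> updates I A 0" using a by simp
    then show ?case by blast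
  next
    case (insert j D)
    have "{i. (y(j := a)) i \<noteq> a} = D" using insert.hyps insert.prems(3) by auto
    moreover have "range (y(j := a)) \<subseteq> A" using insert.prems(2) a by auto
    moreover have "D \<subseteq> I" using insert.prems(1) by simp
    ultimately obtain n where n: "y(j := a) \<in> updates I A n"
      using insert.IH[of "y(j := a)"] by blast
    have "y = (y(j := a))(j := y j)" by simp
    moreover have "j \<in> I" "y j \<in> A" using insert.prems by auto
    ultimately have "y \<in> updates I A (Suc n)"
      using n by (simp del: fun_upd_upd) (rule image_eqI[of _ _ "(y(j := a), j, y j)"], auto)
    then show ?case by blast
  qed
  from this[OF fin sub x refl] show "x \<in> (\<Union>n. updates I A n)" by blast
qed

lemma card_almost_constant:
  assumes I: "infinite I" and A: "|A| \<le>o |I|"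
  shows "|almost_constant I A| \<le>o |I|"
proof -
  have times: "|X \<times> Y| \<le>o |I|" if "|X| \<le>o |I|" "|Y| \<le>o |I|" for X :: "'x set" and Y :: "'y set"
    by (rule card_of_Times_ordLeq_infinite_Field) (use I that in \<open>simp_all add: Field_card_of card_of_card_order_on\<close>)
  have "|updates I A n| \<le>o |I|" for n
  proof (induction n)
    case 0
    show ?case unfolding updates.simps by (rule ordLeq_transitive[OF card_of_image A])
  next
    case (Suc n)
    have "|updates I A n \<times> I \<times> A| \<le>o |I|"
      by (intro times Suc A ordLeq_refl card_of_Card_order)
    then show ?case unfolding updates.simps by (rule ordLeq_transitive[OF card_of_image])
  qed
  then have "|\<Union>n. updates I A n| \<le>o |I|"
    using I by (intro card_of_UNION_ordLeq_infinite) (simp_all add: infinite_iff_card_of_nat)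
  then show ?thesis
    by (rule ordLeq_transitive[OF card_of_mono1[OF almost_constant_updates]])
qed

lemma constant_in_almost_constant: "a \<in> A \<Longrightarrow> (\<lambda>_. a) \<in> almost_constant I A"
  unfolding almost_constant_def by auto

lemma update_in_almost_constant:
  assumes "a \<in> A" "b \<in> A" "i \<in> I"
  shows "(\<lambda>_. a)(i := b) \<in> almost_constant I A"
proof -
  have "{j. ((\<lambda>_. a)(i := b)) j \<noteq> a} \<subseteq> {i}" by auto
  then have "finite {j. ((\<lambda>_. a)(i := b)) j \<noteq> a}" "{j. ((\<lambda>_. a)(i := b)) j \<noteq> a} \<subseteq> I"
    using assms(3) by (blast intro: finite_subset)+
  moreover have "range ((\<lambda>_. a)(i := b)) \<subseteq> A" using assms by auto
  ultimately show ?thesis using assms(1) unfolding almost_constant_def by blast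
qed

lemma almost_constant_pointwise:
  assumes xs: "set xs \<subseteq> almost_constant I A"
    and g: "\<And>as. length as = length xs \<Longrightarrow> set as \<subseteq> A \<Longrightarrow> g as \<in> A"
  shows "(\<lambda>i. g (map (\<lambda>x. x i) xs)) \<in> almost_constant I A"
proof -
  have "\<forall>x \<in> set xs. \<exists>a. a \<in> A \<and> finite {i. x i \<noteq> a} \<and> {i. x i \<noteq> a} \<subseteq> I"
    using xs unfolding almost_constant_def by auto
  then obtain a where a: "\<forall>x \<in> set xs. a x \<in> A \<and> finite {i. x i \<noteq> a x} \<and> {i. x i \<noteq> a x} \<subseteq> I"
    by (rule bchoice[elim_format]) auto
  let ?D = "{i. g (map (\<lambda>x. x i) xs) \<noteq> g (map a xs)}"
  have "?D \<subseteq> (\<Union>x \<in> set xs. {i. x i \<noteq> a x})"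
  proof
    fix i
    assume i: "i \<in> ?D"
    have "map (\<lambda>x. x i) xs \<noteq> map a xs"
    proof
      assume "map (\<lambda>x. x i) xs = map a xs"
      then have "g (map (\<lambda>x. x i) xs) = g (map a xs)" by (rule arg_cong)
      with i show False by simp
    qed
    then show "i \<in> (\<Union>x \<in> set xs. {i. x i \<noteq> a x})" by auto
  qed
  moreover have "finite (\<Union>x \<in> set xs. {i. x i \<noteq> a x})" "(\<Union>x \<in> set xs. {i. x i \<noteq> a x}) \<subseteq> I"
    using a by auto
  ultimately have "finite ?D" "?D \<subseteq> I" by (auto intro: finite_subset)
  moreover have "g (map a xs) \<in> A" by (rule g) (use a in auto)
  moreover have "g (map (\<lambda>x. x i) xs) \<in> A" for i
  proof (rule g)
    have "x i \<in> A" if "x \<in> set xs" for x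
    proof -
      have "x \<in> almost_constant I A" using xs that by blast
      then have "range x \<subseteq> A" unfolding almost_constant_def by simp
      then show ?thesis by blast
    qed
    then show "set (map (\<lambda>x. x i) xs) \<subseteq> A" by auto
  qed simp
  ultimately show ?thesis unfolding almost_constant_def by auto
qed

lemma card_eqI:
  assumes "D \<subseteq> P" "|P| \<le>o |I|" "inj_on f I" "f ` I \<subseteq> D"
  shows "|D| =o |I|"
proof -
  have "|D| \<le>o |I|" by (rule ordLeq_transitive[OF card_of_mono1[OF assms(1)] assms(2)])
  moreover have "|I| \<le>o |D|" using assms(3,4) card_of_ordLeq by blast
  ultimately show ?thesis by (simp add: ordIso_iff_ordLeq)
qed

text \<open>
  The size of the filter and of its complement can be prescribed: a Suszko-reduced matrix with a
  proper filter that has two elements \<open>p\<close> and \<open>r\<close> has a subdirect power in which both are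
  equinumerous with \<open>I\<close>. Changing the constant \<open>p\<close> at one index to \<open>r\<close> gives \<open>|I|\<close> members of the
  filter, changing it to \<open>w\<close> gives \<open>|I|\<close> elements outside. Hence the power can be copied onto
  any two disjoint sets \<open>X\<close> and \<open>Y\<close> of that size, with \<open>X\<close> as its filter, and matrices of two
  unrelated logics can be put on a common carrier with a common filter.
\<close>

lemma Mod_Suszko_resize:
  fixes A :: "('u, 'u) algebra" and I :: "'i set"
  assumes l: "is_logic l" and AF: "(A, F) \<in> Mod_Suszko l"
    and p: "p \<in> F" and r: "r \<in> F" "p \<noteq> r" and w: "w \<in> carr A" "w \<notin> F"
    and I: "infinite I" "|carr A| \<le>o |I|"
    and XY: "X \<inter> Y = {}" "|X| =o |I|" "|Y| =o |I|" and sm: "small (X \<union> Y)"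
  shows "\<exists>A'. carr A' = X \<union> Y \<and> (A', X) \<in> Mod_Suszko l"
proof -
  note A = Mod_SuszkoD[OF AF]
  have FA: "F \<subseteq> carr A" by (rule deductive_filter_subset[OF A(3)])
  define P where "P = almost_constant I (carr A)"
  define PF where "PF = {x \<in> P. range x \<subseteq> F}"
  have cP: "|P| \<le>o |I|" unfolding P_def by (rule card_almost_constant[OF I])
  have cPF: "|PF| =o |I|"
  proof (rule card_eqI[OF _ cP])
    show "inj_on (\<lambda>i. (\<lambda>_. p)(i := r)) I"
      using \<open>p \<noteq> r\<close> by (intro inj_onI) (metis fun_upd_apply)
    show "(\<lambda>i. (\<lambda>_. p)(i := r)) ` I \<subseteq> PF"
      using p r FA unfolding PF_def P_def by (auto intro!: update_in_almost_constant)
  qed (auto simp: PF_def)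
  have cPN: "|P - PF| =o |I|"
  proof (rule card_eqI[OF _ cP])
    have "p \<noteq> w" using p w by auto
    then show "inj_on (\<lambda>i. (\<lambda>_. p)(i := w)) I"
      by (intro inj_onI) (metis fun_upd_apply)
    have "(\<lambda>_. p)(i := w) \<notin> PF" for i
    proof
      assume "(\<lambda>_. p)(i := w) \<in> PF"
      then have "((\<lambda>_. p)(i := w)) i \<in> F" unfolding PF_def by blast
      then show False using w(2) by simp
    qed
    then show "(\<lambda>i. (\<lambda>_. p)(i := w)) ` I \<subseteq> P - PF"
      using p w FA unfolding P_def by (auto intro!: update_in_almost_constant)
  qed auto
  obtain bX where bX: "bij_betw bX X PF"
    using ordIso_transitive[OF XY(2) ordIso_symmetric[OF cPF]] card_of_ordIso by blast
  obtain bY where bY: "bij_betw bY Y (P - PF)"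
    using ordIso_transitive[OF XY(3) ordIso_symmetric[OF cPN]] card_of_ordIso by blast
  define C where "C = X \<union> Y"
  define b where "b u = (if u \<in> X then bX u else bY u)" for u
  have "bij_betw b X PF" using bX by (rule bij_betw_cong[THEN iffD1, rotated]) (simp add: b_def)
  moreover have "bij_betw b Y (P - PF)"
    using bY by (rule bij_betw_cong[THEN iffD1, rotated]) (use XY(1) in \<open>auto simp: b_def\<close>)
  ultimately have "bij_betw b C (PF \<union> (P - PF))" and bXF: "b ` X = PF"
    unfolding C_def using bij_betw_combine[of b X PF Y "P - PF"] bij_betw_imp_surj_on[of b X PF]
    by blast+
  moreover have "PF \<union> (P - PF) = P" unfolding PF_def by blast
  ultimately have b: "bij_betw b C P" by simp
  define A' where
    "A' = \<lparr>carr = C, opn = (\<lambda>s us. inv_into C b (\<lambda>i. opn A s (map (\<lambda>u. b u i) us)))\<rparr>"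
  have carr: "carr A' = C" unfolding A'_def by simp
  have op: "(\<lambda>i. opn A s (map (\<lambda>u. b u i) us)) \<in> P"
    if s: "lang l s = Some (length us)" and us: "set us \<subseteq> C" for s us
  proof -
    have "(\<lambda>i. opn A s (map (\<lambda>x. x i) (map b us))) \<in> almost_constant I (carr A)"
    proof (rule almost_constant_pointwise)
      show "set (map b us) \<subseteq> almost_constant I (carr A)"
        using us b unfolding P_def by (auto simp: bij_betw_def)
      show "opn A s as \<in> carr A" if "length as = length (map b us)" "set as \<subseteq> carr A" for as
        by (rule is_algebraD[OF A(1)]) (use s that in simp_all)
    qed
    then show ?thesis unfolding P_def by (simp add: comp_def)
  qed
  have b_opn: "b (opn A' s us) = (\<lambda>i. opn A s (map (\<lambda>u. b u i) us))"
    and opn_C: "opn A' s us \<in> C"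
    if "lang l s = Some (length us)" "set us \<subseteq> C" for s us
    using op[OF that] b unfolding A'_def
    by (auto simp: bij_betw_def f_inv_into_f intro!: inv_into_into)
  have bC: "b u i \<in> carr A" if "u \<in> C" for u i
  proof -
    have "b u \<in> P" using b that by (auto simp: bij_betw_def)
    then have "range (b u) \<subseteq> carr A" unfolding P_def almost_constant_def by simp
    then show ?thesis by blast
  qed
  have alg: "is_algebra (lang l) A'"
  proof -
    obtain a where "a \<in> carr A" using w by blast
    then have "(\<lambda>_. a) \<in> P" unfolding P_def by (rule constant_in_almost_constant)
    then have "C \<noteq> {}" using b by (auto simp: bij_betw_def)
    then show ?thesis using opn_C carr unfolding is_algebra_def by simp
  qed
  have "(A', {u \<in> carr A'. \<forall>i. b u i \<in> F}) \<in> Mod_Suszko l"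
  proof (rule Mod_Suszko_subdirect[OF l AF alg])
    show "small (carr A')" using sm carr unfolding C_def by simp
    fix i
    show "(\<lambda>u. b u i) \<in> homs (lang l) A' A"
      using b_opn carr bC unfolding homs_def by auto
    show "(\<lambda>u. b u i) ` carr A' = carr A"
    proof
      show "(\<lambda>u. b u i) ` carr A' \<subseteq> carr A" using bC carr by auto
      show "carr A \<subseteq> (\<lambda>u. b u i) ` carr A'"
      proof
        fix a
        assume "a \<in> carr A"
        then have "(\<lambda>_. a) \<in> P" unfolding P_def by (rule constant_in_almost_constant)
        then obtain u where "u \<in> C" "b u = (\<lambda>_. a)" using b by (auto simp: bij_betw_def)
        then show "a \<in> (\<lambda>u. b u i) ` carr A'" using carr by (intro image_eqI[of _ _ u]) auto
      qed
    qed
  next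
    fix u v
    assume "u \<in> carr A'" "v \<in> carr A'" "\<And>i. b u i = b v i"
    then show "u = v" using b carr by (auto simp: bij_betw_def dest: inj_onD)
  qed
  moreover have "{u \<in> carr A'. \<forall>i. b u i \<in> F} = X"
  proof -
    have "u \<in> X \<longleftrightarrow> (\<forall>i. b u i \<in> F)" if "u \<in> C" for u
    proof -
      have "u \<in> X \<longleftrightarrow> b u \<in> PF"
        using bXF b that by (auto simp: bij_betw_def C_def inj_on_def)
      moreover have "b u \<in> P" using b that by (auto simp: bij_betw_def)
      ultimately show ?thesis unfolding PF_def by auto
    qed
    then show ?thesis unfolding carr by (auto simp: C_def)
  qed
  ultimately show ?thesis using carr C_def by auto
qed


section \<open>Logics given by a matrix\<close>

lemma eval_eval:
  assumes A: "is_algebra L A" and e: "e ` V \<subseteq> carr A" and V: "V \<noteq> {}"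
    and \<sigma>: "\<sigma> ` W \<subseteq> terms L V" and t: "t \<in> terms L W"
  shows "eval A e (eval (Fm L V) \<sigma> t) = eval A (\<lambda>x. eval A e (\<sigma> x)) t"
  by (rule hom_eval[OF eval_in_homs[OF A e] is_algebra_Fm[OF V] _ t]) (use \<sigma> in simp)

text \<open>
  The logic with \<open>\<kappa>\<close> variables determined by a single matrix; valuations, rather than
  homomorphisms from the formula algebra, are quantified over, which is the same by
  \<open>hom_Fm_eq_eval\<close>.
\<close>

definition matrix_logic ::
  "'u language \<Rightarrow> 'u \<Rightarrow> ('u, 'a) algebra \<Rightarrow> 'a set \<Rightarrow> 'u logical_system" where
  "matrix_logic L \<kappa> A F = \<lparr>lang = L, vcard = \<kappa>, entails = (\<lambda>\<Gamma> \<phi>.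
     \<Gamma> \<subseteq> terms L (ords_below \<kappa>) \<and> \<phi> \<in> terms L (ords_below \<kappa>) \<and>
     (\<forall>e. e ` ords_below \<kappa> \<subseteq> carr A \<longrightarrow> (\<forall>\<gamma> \<in> \<Gamma>. eval A e \<gamma> \<in> F) \<longrightarrow> eval A e \<phi> \<in> F))\<rparr>"

lemma lang_matrix_logic [simp]: "lang (matrix_logic L \<kappa> A F) = L"
  and vcard_matrix_logic [simp]: "vcard (matrix_logic L \<kappa> A F) = \<kappa>"
  by (simp_all add: matrix_logic_def)

lemma entails_matrix_logic:
  "entails (matrix_logic L \<kappa> A F) \<Gamma> \<phi> \<longleftrightarrow>
     \<Gamma> \<subseteq> terms L (ords_below \<kappa>) \<and> \<phi> \<in> terms L (ords_below \<kappa>) \<and>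
     (\<forall>e. e ` ords_below \<kappa> \<subseteq> carr A \<longrightarrow> (\<forall>\<gamma> \<in> \<Gamma>. eval A e \<gamma> \<in> F) \<longrightarrow> eval A e \<phi> \<in> F)"
  by (simp add: matrix_logic_def)

lemma infinite_cardinal_infinite: "infinite_cardinal \<kappa> \<Longrightarrow> infinite (ords_below \<kappa>)"
  unfolding infinite_cardinal_def by blast

lemma is_logic_matrix_logic:
  assumes "is_language L" "small (dom L)" and \<kappa>: "infinite_cardinal \<kappa>" and A: "is_algebra L A"
  shows "is_logic (matrix_logic L \<kappa> A F)"
proof -
  let ?l = "matrix_logic L \<kappa> A F" and ?V = "ords_below \<kappa>"
  have V: "?V \<noteq> {}" using infinite_cardinal_infinite[OF \<kappa>] by auto
  have "consequence_relation (formulas ?l) (entails ?l)"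
    unfolding consequence_relation_def
  proof (intro conjI allI impI)
    fix \<Gamma> \<Delta> \<phi>
    assume "\<Gamma> \<subseteq> formulas ?l" and \<Delta>: "\<forall>\<delta> \<in> \<Delta>. entails ?l \<Gamma> \<delta>" and "entails ?l \<Delta> \<phi>"
    then show "entails ?l \<Gamma> \<phi>" unfolding entails_matrix_logic by simp
  next
    fix \<Gamma> \<gamma>
    assume "\<Gamma> \<subseteq> formulas ?l" "\<gamma> \<in> \<Gamma>"
    then show "entails ?l \<Gamma> \<gamma>" unfolding entails_matrix_logic by auto
  qed (simp_all add: entails_matrix_logic)
  moreover have "entails ?l (\<sigma> ` \<Gamma>) (\<sigma> \<phi>)"
    if \<sigma>: "\<sigma> \<in> homs L (Fm L ?V) (Fm L ?V)" and ent: "entails ?l \<Gamma> \<phi>" for \<sigma> \<Gamma> \<phi>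
  proof -
    have \<Gamma>: "\<Gamma> \<subseteq> terms L ?V" and \<phi>: "\<phi> \<in> terms L ?V"
      and sound: "\<And>e. e ` ?V \<subseteq> carr A \<Longrightarrow> \<forall>\<gamma> \<in> \<Gamma>. eval A e \<gamma> \<in> F \<Longrightarrow> eval A e \<phi> \<in> F"
      using ent unfolding entails_matrix_logic by simp_all
    have mem: "\<sigma> \<psi> \<in> terms L ?V" if "\<psi> \<in> terms L ?V" for \<psi>
      using homs_carr[OF \<sigma>, of \<psi>] that by simp
    have "eval A e (\<sigma> \<phi>) \<in> F"
      if e: "e ` ?V \<subseteq> carr A" and prem: "\<forall>\<gamma> \<in> \<sigma> ` \<Gamma>. eval A e \<gamma> \<in> F" for e
    proof -
      define d where "d x = eval A e (\<sigma> (Var x))" for x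
      have d: "d ` ?V \<subseteq> carr A"
        using eval_closed[OF A mem e] unfolding d_def by auto
      have eq: "eval A d \<psi> = eval A e (\<sigma> \<psi>)" if "\<psi> \<in> terms L ?V" for \<psi>
      proof -
        have "(\<lambda>x. \<sigma> (Var x)) ` ?V \<subseteq> terms L ?V" using mem by auto
        from eval_eval[OF A e V this that] show ?thesis
          unfolding hom_Fm_eq_eval[OF \<sigma> that] d_def by simp
      qed
      have "\<forall>\<gamma> \<in> \<Gamma>. eval A d \<gamma> \<in> F" using prem eq \<Gamma> by auto
      from sound[OF d this] show ?thesis using eq \<phi> by simp
    qed
    then show ?thesis using \<Gamma> \<phi> mem unfolding entails_matrix_logic by auto
  qed
  ultimately show ?thesis using assms unfolding is_logic_def by simp
qed

lemma deductive_filter_matrix_logic: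
  assumes "is_logic (matrix_logic L \<kappa> A F)" "F \<subseteq> carr A"
  shows "deductive_filter (matrix_logic L \<kappa> A F) A F"
proof (rule deductive_filterI[OF assms])
  show "eval A e \<phi> \<in> F"
    if "entails (matrix_logic L \<kappa> A F) \<Gamma> \<phi>"
      "e ` ords_below (vcard (matrix_logic L \<kappa> A F)) \<subseteq> carr A"
      "\<And>\<gamma>. \<gamma> \<in> \<Gamma> \<Longrightarrow> eval A e \<gamma> \<in> F" for \<Gamma> \<phi> e
    using that unfolding entails_matrix_logic by simp
qed

text \<open>
  The formula algebra of the larger language is itself an algebra, so its reduct exists, and the
  translation of a formula along \<open>\<tau>\<close> is just its value in that reduct.
\<close>

lemma eval_translated:
  assumes D: "is_algebra L D" and d: "d ` V \<subseteq> carr D" and V: "V \<noteq> {}"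
    and \<tau>: "translation L1 L \<tau>" and e: "e ` W \<subseteq> V" and \<gamma>: "\<gamma> \<in> terms L1 W"
  shows "eval (reduct \<tau> (Fm L V)) (\<lambda>x. Var (e x)) \<gamma> \<in> terms L V"
    and "eval D d (eval (reduct \<tau> (Fm L V)) (\<lambda>x. Var (e x)) \<gamma>) =
      eval (reduct \<tau> D) (\<lambda>x. d (e x)) \<gamma>"
proof -
  have sub: "(\<lambda>x. Var (e x)) ` W \<subseteq> carr (reduct \<tau> (Fm L V))" using e by auto
  note Fm = is_algebra_Fm[OF V, of L]
  note red = is_algebra_reduct[OF Fm \<tau>]
  show "eval (reduct \<tau> (Fm L V)) (\<lambda>x. Var (e x)) \<gamma> \<in> terms L V"
    using eval_closed[OF red \<gamma> sub] by simp
  have "eval D d \<in> homs L1 (reduct \<tau> (Fm L V)) (reduct \<tau> D)"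
    by (rule homs_reduct[OF eval_in_homs[OF D d] Fm \<tau>])
  from hom_eval[OF this red sub \<gamma>]
  show "eval D d (eval (reduct \<tau> (Fm L V)) (\<lambda>x. Var (e x)) \<gamma>) =
      eval (reduct \<tau> D) (\<lambda>x. d (e x)) \<gamma>" by simp
qed


section \<open>Test matrices and their models\<close>

text \<open>
  A test matrix has a name \<open>c u\<close> for each of its elements \<open>u\<close>, an element \<open>t\<close> in the filter, an
  element \<open>f\<close> outside, and an operation \<open>q\<close> whose value is in the filter exactly when
  \<open>y = y'\<close> and \<open>z = z'\<close> together imply \<open>x = x'\<close>. The special case \<open>q(y, y, y, y, x, x')\<close> expresses
  equality. Six arguments are used because two points have to be separated in the end: the
  condition \<open>y = a\<close>, \<open>z = b\<close> with named elements \<open>a\<close>, \<open>b\<close> locates both at once.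
\<close>

locale test_matrix =
  fixes L :: "'u language" and A :: "('u, 'u) algebra" and F :: "'u set" and \<kappa> :: 'u
    and c :: "'u \<Rightarrow> 'u" and q t f :: 'u
  assumes lang: "is_language L" "small (dom L)" and \<kappa>: "infinite_cardinal \<kappa>"
    and A: "is_algebra L A" and F: "F \<subseteq> carr A"
    and t: "t \<in> F" and f: "f \<in> carr A" "f \<notin> F"
    and c: "\<And>u. u \<in> carr A \<Longrightarrow> L (c u) = Some 1"
    and c_opn: "\<And>u x. u \<in> carr A \<Longrightarrow> x \<in> carr A \<Longrightarrow> opn A (c u) [x] = u"
    and q: "L q = Some 6"
    and q_opn: "\<And>y z y' z' x x'. set [y, z, y', z', x, x'] \<subseteq> carr A \<Longrightarrow>
      opn A q [y, z, y', z', x, x'] = (if y = y' \<and> z = z' \<and> x \<noteq> x' then f else t)"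
begin

abbreviation mlogic :: "'u logical_system" where
  "mlogic \<equiv> matrix_logic L \<kappa> A F"

lemma t_carr: "t \<in> carr A" using t F by blast

lemma is_logic_mlogic: "is_logic mlogic"
  by (rule is_logic_matrix_logic[OF lang \<kappa> A])

lemma q_holds:
  assumes "set [y, z, y', z', x, x'] \<subseteq> carr A"
  shows "opn A q [y, z, y', z', x, x'] \<in> F \<longleftrightarrow> (y = y' \<longrightarrow> z = z' \<longrightarrow> x = x')"
  using q_opn[OF assms] t f by simp

lemma eval_q_holds:
  assumes "set [y, z, y', z', x, x'] \<subseteq> terms L V" "e ` V \<subseteq> carr A"
  shows "eval A e (Fn q [y, z, y', z', x, x']) \<in> F \<longleftrightarrow>
    (eval A e y = eval A e y' \<longrightarrow> eval A e z = eval A e z' \<longrightarrow> eval A e x = eval A e x')"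
proof -
  have "set (map (eval A e) [y, z, y', z', x, x']) \<subseteq> carr A"
    using assms(1) eval_closed[OF A _ assms(2)] by auto
  then show ?thesis using q_holds by simp
qed

lemma q_term: "Fn q [y, z, y', z', x, x'] \<in> terms L V \<longleftrightarrow> set [y, z, y', z', x, x'] \<subseteq> terms L V"
  using q by simp

lemma q_Suc: "L q = Some (Suc (Suc (Suc (Suc (Suc (Suc 0))))))"
  using q by (simp add: numeral_eq_Suc)

lemma c_term: "u \<in> carr A \<Longrightarrow> Fn (c u) [x] \<in> terms L V \<longleftrightarrow> x \<in> terms L V"
  using c by simp

lemma eval_c:
  assumes "u \<in> carr A" "x \<in> terms L V" "e ` V \<subseteq> carr A"
  shows "eval A e (Fn (c u) [x]) = u"
  using c_opn[OF assms(1) eval_closed[OF A assms(2,3)]] by simp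

end

locale test_model = test_matrix L A F \<kappa> c q t f
  for L :: "'u language" and A F \<kappa> c q t f +
  fixes B :: "('u, 'b) algebra" and G :: "'b set"
  assumes B: "is_algebra L B" and G: "deductive_filter mlogic B G"
begin

text \<open>
  Rules valid in the matrix hold in every model. The variables of the rule are taken to be elements
  of the model itself, evaluated by the identity; at most \<open>\<kappa>\<close> many of them occur, so they can be
  replaced by the official variables. In this form an infinitary rule with a few variables is no
  harder to apply than a finitary one.
\<close>

lemma rule_transfer:
  fixes V :: "'b set"
  assumes V: "V \<subseteq> carr B" "|V| \<le>o |ords_below \<kappa>|"
    and \<Gamma>: "\<Gamma> \<subseteq> terms L V" and \<phi>: "\<phi> \<in> terms L V"
    and valid: "\<And>e. e ` V \<subseteq> carr A \<Longrightarrow> \<forall>\<gamma> \<in> \<Gamma>. eval A e \<gamma> \<in> F \<Longrightarrow> eval A e \<phi> \<in> F"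
    and prem: "\<forall>\<gamma> \<in> \<Gamma>. eval B (\<lambda>x. x) \<gamma> \<in> G"
  shows "eval B (\<lambda>x. x) \<phi> \<in> G"
proof -
  let ?W = "ords_below \<kappa>"
  have W: "?W \<noteq> {}" using infinite_cardinal_infinite[OF \<kappa>] by auto
  obtain \<iota> where inj: "inj_on \<iota> V" and \<iota>: "\<iota> ` V \<subseteq> ?W"
    using card_of_ordLeq[THEN iffD2, OF V(2)] by blast
  obtain b where b: "b \<in> carr B" using B unfolding is_algebra_def by blast
  define r where "r = eval (Fm L ?W) (\<lambda>x. Var (\<iota> x))"
  have sub: "(\<lambda>x. Var (\<iota> x)) ` V \<subseteq> terms L ?W" using \<iota> by auto
  have r: "r \<psi> \<in> terms L ?W" if "\<psi> \<in> terms L V" for \<psi>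
    using eval_closed[OF is_algebra_Fm[OF W] that, of "\<lambda>x. Var (\<iota> x)"] sub unfolding r_def by simp
  have r\<Gamma>: "r ` \<Gamma> \<subseteq> terms L ?W"
  proof
    fix \<psi> assume "\<psi> \<in> r ` \<Gamma>"
    then obtain \<gamma> where "\<gamma> \<in> \<Gamma>" "\<psi> = r \<gamma>" by blast
    then show "\<psi> \<in> terms L ?W" using r[of \<gamma>] \<Gamma> by blast
  qed
  have ent: "entails mlogic (r ` \<Gamma>) (r \<phi>)"
    unfolding entails_matrix_logic
  proof (intro conjI allI impI)
    show "r ` \<Gamma> \<subseteq> terms L ?W" by (rule r\<Gamma>)
    show "r \<phi> \<in> terms L ?W" by (rule r[OF \<phi>])
    fix e
    assume e: "e ` ?W \<subseteq> carr A" and prem: "\<forall>\<gamma> \<in> r ` \<Gamma>. eval A e \<gamma> \<in> F"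
    have rA: "eval A e (r \<psi>) = eval A (\<lambda>x. e (\<iota> x)) \<psi>" if "\<psi> \<in> terms L V" for \<psi>
      using eval_eval[OF A e W sub that] unfolding r_def by simp
    have "\<forall>\<gamma> \<in> \<Gamma>. eval A (\<lambda>x. e (\<iota> x)) \<gamma> \<in> F"
    proof
      fix \<gamma> assume \<gamma>: "\<gamma> \<in> \<Gamma>"
      then have "eval A e (r \<gamma>) \<in> F" using prem by blast
      then show "eval A (\<lambda>x. e (\<iota> x)) \<gamma> \<in> F" using rA[OF subsetD[OF \<Gamma> \<gamma>]] by simp
    qed
    moreover have "(\<lambda>x. e (\<iota> x)) ` V \<subseteq> carr A" using e \<iota> by blast
    ultimately have "eval A (\<lambda>x. e (\<iota> x)) \<phi> \<in> F" by (rule valid[rotated])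
    then show "eval A e (r \<phi>) \<in> F" using rA[OF \<phi>] by simp
  qed
  define d where "d y = (if y \<in> \<iota> ` V then inv_into V \<iota> y else b)" for y
  have d: "d ` ?W \<subseteq> carr B"
  proof
    fix x assume "x \<in> d ` ?W"
    then obtain y where y: "x = d y" by blast
    show "x \<in> carr B"
      using inv_into_into[of y \<iota> V] V(1) b unfolding y d_def by (cases "y \<in> \<iota> ` V") auto
  qed
  have eq: "eval B d (r \<psi>) = eval B (\<lambda>x. x) \<psi>" if \<psi>: "\<psi> \<in> terms L V" for \<psi>
  proof -
    have "eval B d (r \<psi>) = eval B (\<lambda>x. d (\<iota> x)) \<psi>"
      using eval_eval[OF B d W sub \<psi>] unfolding r_def by simp
    also have "\<dots> = eval B (\<lambda>x. x) \<psi>"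
      by (rule eval_cong[OF \<psi>]) (simp add: d_def inj)
    finally show ?thesis .
  qed
  have "eval B d (r \<phi>) \<in> G"
  proof (rule deductive_filter_eval[OF G _ ent])
    fix \<psi> assume "\<psi> \<in> r ` \<Gamma>"
    then obtain \<gamma> where \<gamma>: "\<gamma> \<in> \<Gamma>" "\<psi> = r \<gamma>" by blast
    then show "eval B d \<psi> \<in> G" using eq[of \<gamma>] prem \<Gamma> by auto
  qed (use B d in simp_all)
  then show ?thesis using eq[OF \<phi>] by simp
qed

lemma rule_transfer_finite:
  assumes "finite V" "V \<subseteq> carr B" "\<Gamma> \<subseteq> terms L V" "\<phi> \<in> terms L V"
    and "\<And>e. e ` V \<subseteq> carr A \<Longrightarrow> \<forall>\<gamma> \<in> \<Gamma>. eval A e \<gamma> \<in> F \<Longrightarrow> eval A e \<phi> \<in> F"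
    and "\<forall>\<gamma> \<in> \<Gamma>. eval B (\<lambda>x. x) \<gamma> \<in> G"
  shows "eval B (\<lambda>x. x) \<phi> \<in> G"
proof (rule rule_transfer[OF assms(2) _ assms(3-)])
  have "|V| <o |ords_below \<kappa>|"
    by (rule finite_ordLess_infinite)
      (simp_all add: card_of_well_order_on Field_card_of assms(1) infinite_cardinal_infinite[OF \<kappa>])
  then show "|V| \<le>o |ords_below \<kappa>|" by (rule ordLess_imp_ordLeq)
qed

text \<open>
  The equality of \<open>x\<close> and \<open>x'\<close> relative to the condition that \<open>y = y'\<close> and \<open>z = z'\<close>, as the model
  sees it. The lemmas below show that it is a congruence, since this is a matter of rules valid in
  the matrix; one should think of the quotient as the model restricted to where the condition holds.
\<close>

definition cond_eq :: "'b \<Rightarrow> 'b \<Rightarrow> 'b \<Rightarrow> 'b \<Rightarrow> ('b \<times> 'b) set" where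
  "cond_eq y z y' z' =
    {(x, x'). x \<in> carr B \<and> x' \<in> carr B \<and> opn B q [y, z, y', z', x, x'] \<in> G}"

lemma cond_eqI:
  assumes "finite V" "V \<subseteq> carr B" "\<Gamma> \<subseteq> terms L V" "set [y, z, y', z', x, x'] \<subseteq> terms L V"
    and "\<And>e. e ` V \<subseteq> carr A \<Longrightarrow> \<forall>\<gamma> \<in> \<Gamma>. eval A e \<gamma> \<in> F \<Longrightarrow>
      eval A e y = eval A e y' \<Longrightarrow> eval A e z = eval A e z' \<Longrightarrow> eval A e x = eval A e x'"
    and "\<forall>\<gamma> \<in> \<Gamma>. eval B (\<lambda>x. x) \<gamma> \<in> G"
  shows "(eval B (\<lambda>x. x) x, eval B (\<lambda>x. x) x') \<in>
    cond_eq (eval B (\<lambda>x. x) y) (eval B (\<lambda>x. x) z) (eval B (\<lambda>x. x) y') (eval B (\<lambda>x. x) z')"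
proof -
  have "eval B (\<lambda>x. x) (Fn q [y, z, y', z', x, x']) \<in> G"
  proof (rule rule_transfer_finite[OF assms(1-3)])
    show "Fn q [y, z, y', z', x, x'] \<in> terms L V" by (rule q_term[THEN iffD2, OF assms(4)])
    show "eval A e (Fn q [y, z, y', z', x, x']) \<in> F"
      if "e ` V \<subseteq> carr A" "\<forall>\<gamma> \<in> \<Gamma>. eval A e \<gamma> \<in> F" for e
      using assms(5)[OF that] eval_q_holds[OF assms(4) that(1)] by blast
  qed (rule assms(6))
  moreover have "eval B (\<lambda>x. x) s \<in> carr B" if "s \<in> terms L V" for s
    by (rule eval_closed[OF B that]) (use assms(2) in simp)
  ultimately show ?thesis using assms(4) unfolding cond_eq_def by simp
qed

lemma congruence_cond_eq:
  assumes w: "set [y, z, y', z'] \<subseteq> carr B"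
  shows "congruence L B (cond_eq y z y' z')"
proof (rule congruenceI)
  let ?Q = "\<lambda>x x'. Fn q [Var y, Var z, Var y', Var z', Var x, Var x']"
  show "cond_eq y z y' z' \<subseteq> carr B \<times> carr B" unfolding cond_eq_def by blast
  show "(x, x) \<in> cond_eq y z y' z'" if "x \<in> carr B" for x
    using cond_eqI[of "{y, z, y', z', x}" "{}" "Var y" "Var z" "Var y'" "Var z'" "Var x" "Var x"]
      w that by simp
  show "(x', x) \<in> cond_eq y z y' z'" if x: "(x, x') \<in> cond_eq y z y' z'" for x x'
  proof -
    have "(eval B (\<lambda>x. x) (Var x'), eval B (\<lambda>x. x) (Var x)) \<in> cond_eq (eval B (\<lambda>x. x) (Var y))
      (eval B (\<lambda>x. x) (Var z)) (eval B (\<lambda>x. x) (Var y')) (eval B (\<lambda>x. x) (Var z'))"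
    proof (rule cond_eqI[where V = "{y, z, y', z', x, x'}" and \<Gamma> = "{?Q x x'}"])
      fix e
      assume "e ` {y, z, y', z', x, x'} \<subseteq> carr A" "\<forall>\<gamma> \<in> {?Q x x'}. eval A e \<gamma> \<in> F"
        "eval A e (Var y) = eval A e (Var y')" "eval A e (Var z) = eval A e (Var z')"
      then show "eval A e (Var x') = eval A e (Var x)"
        using eval_q_holds[of "Var y" "Var z" "Var y'" "Var z'" "Var x" "Var x'" "{y, z, y', z', x, x'}" e]
        by simp
    qed (use w x in \<open>auto simp: cond_eq_def q_Suc\<close>)
    then show ?thesis by simp
  qed
  show "(x, x'') \<in> cond_eq y z y' z'"
    if x: "(x, x') \<in> cond_eq y z y' z'" "(x', x'') \<in> cond_eq y z y' z'" for x x' x''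
  proof -
    let ?V = "{y, z, y', z', x, x', x''}" and ?\<Gamma> = "{?Q x x', ?Q x' x''}"
    have "(eval B (\<lambda>x. x) (Var x), eval B (\<lambda>x. x) (Var x'')) \<in> cond_eq (eval B (\<lambda>x. x) (Var y))
      (eval B (\<lambda>x. x) (Var z)) (eval B (\<lambda>x. x) (Var y')) (eval B (\<lambda>x. x) (Var z'))"
    proof (rule cond_eqI[where V = ?V and \<Gamma> = ?\<Gamma>])
      fix e
      assume "e ` ?V \<subseteq> carr A" "\<forall>\<gamma> \<in> ?\<Gamma>. eval A e \<gamma> \<in> F"
        "eval A e (Var y) = eval A e (Var y')" "eval A e (Var z) = eval A e (Var z')"
      then show "eval A e (Var x) = eval A e (Var x'')"
        using eval_q_holds[of "Var y" "Var z" "Var y'" "Var z'" "Var x" "Var x'" ?V e]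
          eval_q_holds[of "Var y" "Var z" "Var y'" "Var z'" "Var x'" "Var x''" ?V e]
        by simp
    qed (use w x in \<open>auto simp: cond_eq_def q_Suc\<close>)
    then show ?thesis by simp
  qed
  show "(opn B s as, opn B s bs) \<in> cond_eq y z y' z'"
    if s: "L s = Some (length as)" and ab: "list_all2 (\<lambda>a b. (a, b) \<in> cond_eq y z y' z') as bs"
    for s as bs
  proof -
    let ?V = "{y, z, y', z'} \<union> set as \<union> set bs" and ?\<Gamma> = "(\<lambda>(a, b). ?Q a b) ` set (zip as bs)"
    have len: "length as = length bs" using ab by (rule list_all2_lengthD)
    have pair: "(a, b) \<in> cond_eq y z y' z'" if "(a, b) \<in> set (zip as bs)" for a b
      using ab that by (auto simp: list_all2_iff)
    have carr: "set as \<subseteq> carr B" "set bs \<subseteq> carr B"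
      using ab by (induction rule: list_all2_induct) (auto simp: cond_eq_def)
    have "(eval B (\<lambda>x. x) (Fn s (map Var as)), eval B (\<lambda>x. x) (Fn s (map Var bs))) \<in>
      cond_eq (eval B (\<lambda>x. x) (Var y))
      (eval B (\<lambda>x. x) (Var z)) (eval B (\<lambda>x. x) (Var y')) (eval B (\<lambda>x. x) (Var z'))"
    proof (rule cond_eqI[where V = ?V and \<Gamma> = ?\<Gamma>])
      show "?\<Gamma> \<subseteq> terms L ?V"
        by (auto simp: q_Suc dest: set_zip_leftD set_zip_rightD)
      fix e
      assume e: "e ` ?V \<subseteq> carr A" and prem: "\<forall>\<gamma> \<in> ?\<Gamma>. eval A e \<gamma> \<in> F"
        and w: "eval A e (Var y) = eval A e (Var y')" "eval A e (Var z) = eval A e (Var z')"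
      have "e a = e b" if "(a, b) \<in> set (zip as bs)" for a b
      proof -
        have "eval A e (?Q a b) \<in> F" using prem that by force
        moreover have "set [Var y, Var z, Var y', Var z', Var a, Var b] \<subseteq> terms L ?V"
          using that by (auto dest: set_zip_leftD set_zip_rightD)
        note eval_q_holds[OF this e]
        ultimately show ?thesis using w by simp
      qed
      then have "map e as = map e bs"
        using len by (auto simp: list_eq_iff_nth_eq in_set_zip)
      then show "eval A e (Fn s (map Var as)) = eval A e (Fn s (map Var bs))"
        by (simp add: comp_def)
    next
      show "set [Var y, Var z, Var y', Var z', Fn s (map Var as), Fn s (map Var bs)] \<subseteq> terms L ?V"
        using s len by auto
      show "\<forall>\<gamma> \<in> ?\<Gamma>. eval B (\<lambda>x. x) \<gamma> \<in> G"
        using pair by (auto simp: cond_eq_def)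
    qed (use w carr in auto)
    then show ?thesis by (simp add: comp_def)
  qed
qed

text \<open>
  The condition \<open>y = y\<close> is void, so this is the equality defined by \<open>q\<close>; the reason is the rule
  that elements equal to a member of the filter belong to it.
\<close>

lemma cond_eq_compatible:
  assumes "y \<in> carr B"
  shows "compatible (cond_eq y y y y) G"
  unfolding compatible_def
proof (intro allI impI)
  fix x x'
  assume x: "x \<in> G" "(x, x') \<in> cond_eq y y y y"
  let ?Q = "Fn q [Var y, Var y, Var y, Var y, Var x, Var x']"
  have "eval B (\<lambda>x. x) (Var x') \<in> G"
  proof (rule rule_transfer_finite[where V = "{y, x, x'}" and \<Gamma> = "{Var x, ?Q}"])
    fix e
    assume e: "e ` {y, x, x'} \<subseteq> carr A" and prem: "\<forall>\<gamma> \<in> {Var x, ?Q}. eval A e \<gamma> \<in> F"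
    have "eval A e ?Q \<in> F" "eval A e (Var x) \<in> F" using prem by blast+
    then show "eval A e (Var x') \<in> F"
      using eval_q_holds[of "Var y" "Var y" "Var y" "Var y" "Var x" "Var x'" "{y, x, x'}" e] e
      by simp
  qed (use assms x in \<open>auto simp: cond_eq_def q_Suc\<close>)
  then show "x' \<in> G" by simp
qed

text \<open>
  How to recognise filters of another logic \<open>l\<close> on the reduct of a model: suppose that \<open>K\<close> is a
  formula context with finitely many parameters such that, for each valuation in the matrix,
  the elements placed by \<open>K\<close> into \<open>F\<close> form some \<open>l\<close>-filter. Then every rule of \<open>l\<close>, translated and
  put into the context, is valid in the matrix, hence holds in the model. The bound on the number of
  variables of \<open>l\<close> makes the translated rule a rule with at most \<open>\<kappa>\<close> variables.
\<close>

lemma deductive_filter_reductI: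
  fixes K :: "('u, 'b) trm \<Rightarrow> ('u, 'b) trm"
  assumes l: "is_logic l" and \<tau>: "translation (lang l) L \<tau>"
    and card: "|ords_below (vcard l)| \<le>o |ords_below \<kappa>|"
    and W: "finite W" "W \<subseteq> carr B"
    and K: "\<And>V s. W \<subseteq> V \<Longrightarrow> s \<in> terms L V \<Longrightarrow> K s \<in> terms L V"
    and K_eval: "\<And>s. eval B (\<lambda>x. x) (K s) = k (eval B (\<lambda>x. x) s)"
    and K_filter: "\<And>V e. W \<subseteq> V \<Longrightarrow> e ` V \<subseteq> carr A \<Longrightarrow> \<exists>H. deductive_filter l (reduct \<tau> A) H \<and>
      (\<forall>s \<in> terms L V. eval A e (K s) \<in> F \<longleftrightarrow> eval A e s \<in> H)"
  shows "deductive_filter l (reduct \<tau> B) {x \<in> carr B. k x \<in> G}"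
proof (rule deductive_filterI[OF l])
  fix \<Gamma> \<phi> e
  let ?O = "ords_below (vcard l)"
  assume ent: "entails l \<Gamma> \<phi>" and e: "e ` ?O \<subseteq> carr (reduct \<tau> B)"
    and prem: "\<And>\<gamma>. \<gamma> \<in> \<Gamma> \<Longrightarrow> eval (reduct \<tau> B) e \<gamma> \<in> {x \<in> carr B. k x \<in> G}"
  note fm = is_logic_entails_formulas[OF l ent]
  have "infinite_cardinal (vcard l)" using l unfolding is_logic_def by (elim conjE)
  note inf = infinite_cardinal_infinite[OF this] infinite_cardinal_infinite[OF \<kappa>]
  define V where "V = e ` ?O \<union> W"
  define T where "T = eval (reduct \<tau> (Fm L V)) (\<lambda>x. Var (e x))"
  have V: "V \<subseteq> carr B" "V \<noteq> {}" "e ` ?O \<subseteq> V" "W \<subseteq> V"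
    using e W inf(1) unfolding V_def by auto
  have T: "T \<gamma> \<in> terms L V"
    and T_B: "eval B (\<lambda>x. x) (T \<gamma>) = eval (reduct \<tau> B) e \<gamma>"
    if "\<gamma> \<in> terms (lang l) ?O" for \<gamma>
    using eval_translated[OF B _ V(2) \<tau> V(3) that, of "\<lambda>x. x"] V(1) unfolding T_def by simp_all
  have T_A: "eval A d (T \<gamma>) = eval (reduct \<tau> A) (\<lambda>x. d (e x)) \<gamma>"
    if "d ` V \<subseteq> carr A" "\<gamma> \<in> terms (lang l) ?O" for d \<gamma>
    using eval_translated(2)[OF A that(1) V(2) \<tau> V(3) that(2)] unfolding T_def .
  have "eval B (\<lambda>x. x) (K (T \<phi>)) \<in> G"
  proof (rule rule_transfer[OF V(1)])
    have "|W| \<le>o |ords_below \<kappa>|"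
      using W(1) inf(2) by (intro ordLess_imp_ordLeq finite_ordLess_infinite)
        (simp_all add: card_of_well_order_on Field_card_of)
    moreover have "|e ` ?O| \<le>o |ords_below \<kappa>|"
      by (rule ordLeq_transitive[OF card_of_image card])
    ultimately show "|V| \<le>o |ords_below \<kappa>|"
      unfolding V_def using inf(2)
      by (intro card_of_Un_ordLeq_infinite_Field) (simp_all add: Field_card_of card_of_card_order_on)
    show "(\<lambda>\<gamma>. K (T \<gamma>)) ` \<Gamma> \<subseteq> terms L V"
    proof
      fix s assume "s \<in> (\<lambda>\<gamma>. K (T \<gamma>)) ` \<Gamma>"
      then obtain \<gamma> where "\<gamma> \<in> \<Gamma>" and s: "s = K (T \<gamma>)" by blast
      then show "s \<in> terms L V" using K[OF V(4) T] fm(1) by blast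
    qed
    show "K (T \<phi>) \<in> terms L V" by (rule K[OF V(4) T[OF fm(2)]])
    show "\<forall>s \<in> (\<lambda>\<gamma>. K (T \<gamma>)) ` \<Gamma>. eval B (\<lambda>x. x) s \<in> G"
    proof
      fix s assume "s \<in> (\<lambda>\<gamma>. K (T \<gamma>)) ` \<Gamma>"
      then obtain \<gamma> where \<gamma>: "\<gamma> \<in> \<Gamma>" and s: "s = K (T \<gamma>)" by blast
      have "\<gamma> \<in> terms (lang l) ?O" using fm(1) \<gamma> by blast
      then show "eval B (\<lambda>x. x) s \<in> G" using prem[OF \<gamma>] unfolding s K_eval by (simp add: T_B)
    qed
    fix d
    assume d: "d ` V \<subseteq> carr A" and dprem: "\<forall>s \<in> (\<lambda>\<gamma>. K (T \<gamma>)) ` \<Gamma>. eval A d s \<in> F"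
    obtain H where H: "deductive_filter l (reduct \<tau> A) H"
      and KH: "\<forall>s \<in> terms L V. eval A d (K s) \<in> F \<longleftrightarrow> eval A d s \<in> H"
      using K_filter[OF V(4) d] by blast
    have "eval (reduct \<tau> A) (\<lambda>x. d (e x)) \<phi> \<in> H"
    proof (rule deductive_filter_eval[OF H is_algebra_reduct[OF A \<tau>] ent])
      show "(\<lambda>x. d (e x)) ` ?O \<subseteq> carr (reduct \<tau> A)" using d V(3) by auto
      fix \<gamma> assume \<gamma>: "\<gamma> \<in> \<Gamma>"
      then have \<gamma>': "\<gamma> \<in> terms (lang l) ?O" using fm(1) by blast
      have "eval A d (K (T \<gamma>)) \<in> F" using dprem \<gamma> by blast
      then show "eval (reduct \<tau> A) (\<lambda>x. d (e x)) \<gamma> \<in> H"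
        using KH T[OF \<gamma>'] T_A[OF d \<gamma>'] by simp
    qed
    then show "eval A d (K (T \<phi>)) \<in> F" using KH T[OF fm(2)] T_A[OF d fm(2)] by simp
  qed
  then have "k (eval (reduct \<tau> B) e \<phi>) \<in> G" unfolding K_eval T_B[OF fm(2)] .
  moreover have "eval (reduct \<tau> B) e \<phi> \<in> carr B"
    using eval_closed[OF is_algebra_reduct[OF B \<tau>] fm(2) e] by simp
  ultimately show "eval (reduct \<tau> B) e \<phi> \<in> {x \<in> carr B. k x \<in> G}" by simp
qed auto

end

locale reduced_test_model = test_model L A F \<kappa> c q t f B G
  for L :: "'u language" and A F \<kappa> c q t f and B :: "('u, 'b) algebra" and G +
  assumes reduced: "\<And>x x'. (x, x') \<in> suszko mlogic B G \<Longrightarrow> x = x'"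
begin

text \<open>
  In a reduced model \<open>q\<close> expresses true equality. The relation defined by the equality formula grows
  with the filter and is always a compatible congruence, so it is contained in the Leibniz
  congruence of every larger filter and thus in the Suszko congruence.
\<close>

lemma cond_eq_trivial:
  assumes y: "y \<in> carr B" and x: "(x, x') \<in> cond_eq y y y y"
  shows "x = x'"
proof (rule reduced)
  show "(x, x') \<in> suszko mlogic B G"
    unfolding suszko_leibniz
  proof (intro allI impI)
    fix H
    assume H: "deductive_filter mlogic B H" "G \<subseteq> H"
    interpret H: test_model L A F \<kappa> c q t f B H by unfold_locales (rule B, rule H(1))
    have "H.cond_eq y y y y \<subseteq> leibniz (lang mlogic) B H"
      unfolding lang_matrix_logic
      by (rule leibniz_maximal[OF B H.congruence_cond_eq H.cond_eq_compatible]) (use y in simp_all)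
    moreover have "(x, x') \<in> H.cond_eq y y y y"
      using x H(2) unfolding cond_eq_def H.cond_eq_def by auto
    ultimately show "(x, x') \<in> leibniz (lang mlogic) B H" by blast
  qed
qed

lemma equation_transfer:
  assumes "finite V" "V \<subseteq> carr B" "s \<in> terms L V" "s' \<in> terms L V"
    and "\<And>e. e ` V \<subseteq> carr A \<Longrightarrow> eval A e s = eval A e s'"
  shows "eval B (\<lambda>x. x) s = eval B (\<lambda>x. x) s'"
proof -
  have s: "eval B (\<lambda>x. x) s \<in> carr B"
    by (rule eval_closed[OF B assms(3)]) (use assms(2) in simp)
  show ?thesis
    by (rule cond_eq_trivial[OF s], rule cond_eqI[OF assms(1,2), of "{}"]) (use assms in simp_all)
qed

text \<open>
  The element of the model named by \<open>c u\<close>. Constants are unary symbols, so an argument has to be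
  chosen; \<open>opn_c\<close> shows that it is immaterial.
\<close>

definition named :: "'u \<Rightarrow> 'b" where
  "named u = opn B (c u) [SOME x. x \<in> carr B]"

lemma opn_c:
  assumes u: "u \<in> carr A" and x: "x \<in> carr B"
  shows "opn B (c u) [x] = named u"
proof -
  define b where "b = (SOME x. x \<in> carr B)"
  have b: "b \<in> carr B" unfolding b_def using x by (rule someI)
  have "eval B (\<lambda>x. x) (Fn (c u) [Var x]) = eval B (\<lambda>x. x) (Fn (c u) [Var b])"
    by (rule equation_transfer[of "{x, b}"]) (use x b u in \<open>simp_all add: c c_opn\<close>)
  then show ?thesis unfolding named_def b_def by simp
qed

text \<open>
  The operation table of \<open>A\<close> is a set of equations between names, and it holds in every reduced
  model.
\<close>

lemma named_hom: "named \<in> homs L A B"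
proof -
  obtain b where b: "b \<in> carr B" using B unfolding is_algebra_def by blast
  have carr: "named u \<in> carr B" if "u \<in> carr A" for u
    using is_algebraD[OF B, of "c u" "[b]"] c[OF that] opn_c[OF that b] b by simp
  have "named (opn A s us) = opn B s (map named us)"
    if s: "L s = Some (length us)" and us: "set us \<subseteq> carr A" for s us
  proof -
    have op: "opn A s us \<in> carr A" by (rule is_algebraD[OF A s us])
    let ?us = "map (\<lambda>u. Fn (c u) [Var b]) us"
    have "eval B (\<lambda>x. x) (Fn s ?us) = eval B (\<lambda>x. x) (Fn (c (opn A s us)) [Var b])"
    proof (rule equation_transfer[of "{b}"])
      have "Fn (c u) [Var b] \<in> terms L {b}" if "u \<in> set us" for u
        by (rule c_term[THEN iffD2]) (use us that in auto)
      then show "Fn s ?us \<in> terms L {b}" using s by auto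
      fix e
      assume e: "e ` {b} \<subseteq> carr A"
      have "eval A e (Fn (c u) [Var b]) = u" if "u \<in> set us" for u
        by (rule eval_c[OF _ _ e]) (use us that in auto)
      then have "map (eval A e) ?us = us" unfolding map_map comp_def by (intro map_idI)
      then show "eval A e (Fn s ?us) = eval A e (Fn (c (opn A s us)) [Var b])"
        using c_opn[OF op] e by simp
    qed (use b c[OF op] in simp_all)
    moreover have "map (eval B (\<lambda>x. x)) ?us = map named us"
    proof -
      have "eval B (\<lambda>x. x) (Fn (c u) [Var b]) = named u" if "u \<in> set us" for u
        using opn_c[of u b] us that b by auto
      then show ?thesis unfolding map_map comp_def by (intro map_cong refl)
    qed
    ultimately show ?thesis using opn_c[OF op b] by (simp del: map_map)
  qed
  moreover have "named ` carr A \<subseteq> carr B" by (intro image_subsetI carr)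
  ultimately show ?thesis unfolding homs_def by simp
qed

lemma named_carr: "u \<in> carr A \<Longrightarrow> named u \<in> carr B"
  by (rule homs_carr[OF named_hom])

text \<open>
  Distinct elements \<open>y\<close>, \<open>z\<close> of a reduced model can be located at distinct elements \<open>a\<close>, \<open>b\<close> of the
  matrix: the condition \<open>y = a\<close>, \<open>z = b\<close> is not refuted. This rests on one infinitary rule in two
  variables, valid in the matrix: if all conditions with \<open>a \<noteq> b\<close> are refuted, then \<open>y = z\<close>.
\<close>

lemma separated_by_elements:
  assumes y: "y \<in> carr B" and z: "z \<in> carr B" and "y \<noteq> z"
  obtains a b where "a \<in> carr A" "b \<in> carr A" "a \<noteq> b"
    "(named f, named t) \<notin> cond_eq y z (named a) (named b)"
proof (rule ccontr)
  assume neg: "\<not> thesis"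
  let ?N = "\<lambda>(a, b). Fn q [Var y, Var z, Fn (c a) [Var y], Fn (c b) [Var y],
    Fn (c f) [Var y], Fn (c t) [Var y]]"
  let ?P = "{(a, b). a \<in> carr A \<and> b \<in> carr A \<and> a \<noteq> b}"
  have N: "set [Var y, Var z, Fn (c a) [Var y], Fn (c b) [Var y], Fn (c f) [Var y], Fn (c t) [Var y]]
      \<subseteq> terms L {y, z}" if "a \<in> carr A" "b \<in> carr A" for a b
    using that f t_carr c by simp
  have "(eval B (\<lambda>x. x) (Var y), eval B (\<lambda>x. x) (Var z)) \<in> cond_eq (eval B (\<lambda>x. x) (Var y))
    (eval B (\<lambda>x. x) (Var y)) (eval B (\<lambda>x. x) (Var y)) (eval B (\<lambda>x. x) (Var y))"
  proof (rule cond_eqI[where V = "{y, z}" and \<Gamma> = "?N ` ?P"])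
    show "?N ` ?P \<subseteq> terms L {y, z}"
    proof
      fix s assume "s \<in> ?N ` ?P"
      then obtain a b where "a \<in> carr A" "b \<in> carr A" and s: "s = ?N (a, b)" by blast
      then show "s \<in> terms L {y, z}" using q_term[THEN iffD2, OF N] by simp
    qed
    show "\<forall>s \<in> ?N ` ?P. eval B (\<lambda>x. x) s \<in> G"
    proof
      fix s assume "s \<in> ?N ` ?P"
      then obtain a b where ab: "a \<in> carr A" "b \<in> carr A" "a \<noteq> b" and s: "s = ?N (a, b)" by blast
      have "(named f, named t) \<in> cond_eq y z (named a) (named b)"
      proof (rule ccontr)
        assume "(named f, named t) \<notin> cond_eq y z (named a) (named b)"
        then have thesis by (rule that[OF ab])
        with neg show False by (rule notE)
      qed
      then show "eval B (\<lambda>x. x) s \<in> G"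
        using ab s f t_carr y by (simp add: cond_eq_def opn_c)
    qed
    fix e
    assume e: "e ` {y, z} \<subseteq> carr A" and prem: "\<forall>s \<in> ?N ` ?P. eval A e s \<in> F"
    show "eval A e (Var y) = eval A e (Var z)"
    proof (rule ccontr)
      assume "eval A e (Var y) \<noteq> eval A e (Var z)"
      then have ne: "e y \<noteq> e z" by simp
      have ey: "e y \<in> carr A" "e z \<in> carr A" using e by auto
      then have "eval A e (?N (e y, e z)) \<in> F" using prem ne by blast
      then have "f = t"
        using eval_q_holds[OF N[OF ey] e] ey f t_carr by (simp add: c_opn)
      then show False using f t by simp
    qed
  qed (use y z in simp_all)
  then show False using cond_eq_trivial[OF y] \<open>y \<noteq> z\<close> by simp
qed

lemma reduct_filter:
  assumes l: "is_logic l" and \<tau>: "translation (lang l) L \<tau>"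
    and card: "|ords_below (vcard l)| \<le>o |ords_below \<kappa>|"
    and F_filter: "deductive_filter l (reduct \<tau> A) F"
  shows "deductive_filter l (reduct \<tau> B) G"
proof -
  have "deductive_filter l (reduct \<tau> B) {x \<in> carr B. x \<in> G}"
  proof (rule deductive_filter_reductI[OF l \<tau> card, where W = "{}" and K = "\<lambda>s. s"])
    show "\<exists>H. deductive_filter l (reduct \<tau> A) H \<and>
      (\<forall>s \<in> terms L V. eval A e s \<in> F \<longleftrightarrow> eval A e s \<in> H)" for V :: "'b set" and e
      using F_filter by blast
  qed simp_all
  moreover have "{x \<in> carr B. x \<in> G} = G" using deductive_filter_subset[OF G] by blast
  ultimately show ?thesis by simp
qed

text \<open>
  Distinct elements \<open>y\<close>, \<open>z\<close> of a reduced model are separated by an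
  \<open>l\<close>-filter on the reduct. Locate \<open>y\<close>, \<open>z\<close> at \<open>a \<noteq> b\<close>, and let \<open>H\<close> be an \<open>l\<close>-filter on the
  matrix that separates \<open>a\<close> from \<open>b\<close> and is tested by the unary symbol \<open>s\<close>. The set \<open>M\<close> of those
  \<open>x\<close> that lie in \<open>H\<close> as far as the condition \<open>y = a\<close>, \<open>z = b\<close> holds is an \<open>l\<close>-filter above \<open>G\<close>.
  Its Leibniz congruence contains \<open>\<rho>\<close>, the equality under the condition, and therefore identifies
  \<open>y\<close> with \<open>a\<close> and \<open>z\<close> with \<open>b\<close>. If it identified \<open>y\<close> with \<open>z\<close>, it would identify the names of \<open>a\<close>
  and \<open>b\<close>. But the names form a copy of the matrix in which \<open>M\<close> restricts to \<open>H\<close>, because the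
  condition is not refuted; so \<open>a\<close> and \<open>b\<close> would be identified by the Leibniz congruence of \<open>H\<close>.
\<close>

lemma suszko_reduct_trivial:
  assumes l: "is_logic l" and \<tau>: "translation (lang l) L \<tau>"
    and card: "|ords_below (vcard l)| \<le>o |ords_below \<kappa>|"
    and sep: "\<And>a b. a \<in> carr A \<Longrightarrow> b \<in> carr A \<Longrightarrow> a \<noteq> b \<Longrightarrow>
      \<exists>H s. deductive_filter l (reduct \<tau> A) H \<and> F \<subseteq> H \<and>
        (a, b) \<notin> leibniz (lang l) (reduct \<tau> A) H \<and>
        L s = Some 1 \<and> (\<forall>x \<in> carr A. opn A s [x] = (if x \<in> H then t else f))"
    and yz: "(y, z) \<in> suszko l (reduct \<tau> B) G" and y: "y \<in> carr B" and z: "z \<in> carr B"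
  shows "y = z"
proof (rule ccontr)
  assume "y \<noteq> z"
  then obtain a b where ab: "a \<in> carr A" "b \<in> carr A" "a \<noteq> b"
    and ft: "(named f, named t) \<notin> cond_eq y z (named a) (named b)"
    by (rule separated_by_elements[OF y z])
  obtain H s where H: "deductive_filter l (reduct \<tau> A) H" "F \<subseteq> H"
    and nH: "(a, b) \<notin> leibniz (lang l) (reduct \<tau> A) H"
    and s: "L s = Some 1" and s_opn: "\<forall>x \<in> carr A. opn A s [x] = (if x \<in> H then t else f)"
    using sep[OF ab] by blast
  define \<rho> where "\<rho> = cond_eq y z (named a) (named b)"
  have \<rho>: "congruence L B \<rho>"
    unfolding \<rho>_def by (rule congruence_cond_eq) (use y z ab named_carr in simp)
  define M where "M = {x \<in> carr B. opn B q [y, z, named a, named b, opn B s [x], named t] \<in> G}"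
  note redA = is_algebra_reduct[OF A \<tau>] and redB = is_algebra_reduct[OF B \<tau>]
  have sB: "opn B s [x] \<in> carr B" if "x \<in> carr B" for x
    by (rule is_algebraD[OF B]) (use s that in simp_all)
  have M_iff: "x \<in> M \<longleftrightarrow> (opn B s [x], named t) \<in> \<rho>" if "x \<in> carr B" for x
    using that sB[OF that] named_carr[OF t_carr] unfolding M_def \<rho>_def cond_eq_def by simp
  let ?K = "\<lambda>r. Fn q [Var y, Var z, Fn (c a) [Var y], Fn (c b) [Var y], Fn s [r], Fn (c t) [Var y]]"
  have K_set: "set [Var y, Var z, Fn (c a) [Var y], Fn (c b) [Var y], Fn s [r], Fn (c t) [Var y]] \<subseteq> terms L V"
    if "{y, z} \<subseteq> V" "r \<in> terms L V" for r V
    using that ab t_carr s c by simp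
  have K_eval: "eval B (\<lambda>x. x) (?K r) = opn B q [y, z, named a, named b, opn B s [eval B (\<lambda>x. x) r], named t]" for r
    using opn_c[OF _ y] ab t_carr by simp
  have K_holds: "eval A e (?K r) \<in> F \<longleftrightarrow> (e y = a \<longrightarrow> e z = b \<longrightarrow> eval A e r \<in> H)"
    if V: "{y, z} \<subseteq> V" and e: "e ` V \<subseteq> carr A" and r: "r \<in> terms L V" for V e r
  proof -
    have ey: "e y \<in> carr A" using V e by blast
    have r': "eval A e r \<in> carr A" by (rule eval_closed[OF A r e])
    have "t \<noteq> f" using t f by auto
    then show ?thesis
      using eval_q_holds[OF K_set[OF V r] e] s_opn r' c_opn[OF _ ey] ab t_carr
      by (simp del: eval.simps(2)) (auto simp: c_opn[OF _ ey])
  qed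
  have M_filter: "deductive_filter l (reduct \<tau> B) M"
    unfolding M_def
  proof (rule deductive_filter_reductI[OF l \<tau> card, where W = "{y, z}" and K = ?K])
    show "?K r \<in> terms L V" if "{y, z} \<subseteq> V" "r \<in> terms L V" for V r
      by (rule q_term[THEN iffD2, OF K_set[OF that]])
    show "eval B (\<lambda>x. x) (?K r) = opn B q [y, z, named a, named b, opn B s [eval B (\<lambda>x. x) r], named t]" for r
      by (rule K_eval)
    fix V :: "'b set" and e
    assume V: "{y, z} \<subseteq> V" and e: "e ` V \<subseteq> carr A"
    \<comment> \<open>A valuation that violates the condition satisfies every instance of the context.\<close>
    let ?H = "if e y = a \<and> e z = b then H else carr A"
    have "deductive_filter l (reduct \<tau> A) ?H"
      using H(1) deductive_filter_carr[OF l redA] by simp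
    moreover have "\<forall>r \<in> terms L V. eval A e (?K r) \<in> F \<longleftrightarrow> eval A e r \<in> ?H"
      using K_holds[OF V e] eval_closed[OF A _ e] by simp
    ultimately show "\<exists>H. deductive_filter l (reduct \<tau> A) H \<and>
      (\<forall>r \<in> terms L V. eval A e (?K r) \<in> F \<longleftrightarrow> eval A e r \<in> H)" by blast
  qed (use y z in simp_all)
  have "G \<subseteq> M"
  proof
    fix x
    assume x: "x \<in> G"
    then have xB: "x \<in> carr B" using deductive_filter_subset[OF G] by blast
    have V: "{y, z} \<subseteq> {y, z, x}" "Var x \<in> terms L {y, z, x}" by auto
    have "eval B (\<lambda>x. x) (?K (Var x)) \<in> G"
    proof (rule rule_transfer_finite[where V = "{y, z, x}" and \<Gamma> = "{Var x}"])
      show "?K (Var x) \<in> terms L {y, z, x}" by (rule q_term[THEN iffD2, OF K_set[OF V]])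
      fix e
      assume e: "e ` {y, z, x} \<subseteq> carr A" and prem: "\<forall>\<gamma> \<in> {Var x}. eval A e \<gamma> \<in> F"
      then have "eval A e (Var x) \<in> H" using H(2) by blast
      then show "eval A e (?K (Var x)) \<in> F" using K_holds[OF V(1) e V(2)] by blast
    qed (use x xB y z in simp_all)
    then show "x \<in> M" using xB unfolding K_eval M_def by simp
  qed
  define \<Theta> where "\<Theta> = leibniz (lang l) (reduct \<tau> B) M"
  have \<Theta>: "congruence (lang l) (reduct \<tau> B) \<Theta>" "compatible \<Theta> M"
    unfolding \<Theta>_def by (rule leibniz_congruence[OF redB], rule leibniz_compatible[OF redB])
  have yz\<Theta>: "(y, z) \<in> \<Theta>"
    using yz M_filter \<open>G \<subseteq> M\<close> unfolding suszko_leibniz \<Theta>_def by blast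
  have "compatible \<rho> M"
    unfolding compatible_def
  proof (intro allI impI)
    fix x x'
    assume x: "x \<in> M" "(x, x') \<in> \<rho>"
    then have carr: "x \<in> carr B" "x' \<in> carr B" using congruence_carr[OF \<rho>] by blast+
    have "(opn B s [x], opn B s [x']) \<in> \<rho>" by (rule congruence_opn[OF \<rho>]) (use s x in simp_all)
    from congruence_trans[OF \<rho> congruence_sym[OF \<rho> this] M_iff[THEN iffD1, OF carr(1) x(1)]]
    show "x' \<in> M" using M_iff[OF carr(2)] by simp
  qed
  then have \<rho>\<Theta>: "\<rho> \<subseteq> \<Theta>"
    unfolding \<Theta>_def by (rule leibniz_maximal[OF redB congruence_reduct[OF \<rho> \<tau>]])
  have "(eval B (\<lambda>x. x) (Var y), eval B (\<lambda>x. x) (Fn (c a) [Var y])) \<in> cond_eq (eval B (\<lambda>x. x) (Var y))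
    (eval B (\<lambda>x. x) (Var z)) (eval B (\<lambda>x. x) (Fn (c a) [Var y])) (eval B (\<lambda>x. x) (Fn (c b) [Var y]))"
    by (rule cond_eqI[where V = "{y, z}" and \<Gamma> = "{}"]) (use y z ab c in simp_all)
  then have ya: "(y, named a) \<in> \<Theta>" using \<rho>\<Theta> ab opn_c[OF _ y] unfolding \<rho>_def by auto
  have "(eval B (\<lambda>x. x) (Var z), eval B (\<lambda>x. x) (Fn (c b) [Var y])) \<in> cond_eq (eval B (\<lambda>x. x) (Var y))
    (eval B (\<lambda>x. x) (Var z)) (eval B (\<lambda>x. x) (Fn (c a) [Var y])) (eval B (\<lambda>x. x) (Fn (c b) [Var y]))"
    by (rule cond_eqI[where V = "{y, z}" and \<Gamma> = "{}"]) (use y z ab c in simp_all)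
  then have zb: "(z, named b) \<in> \<Theta>" using \<rho>\<Theta> ab opn_c[OF _ y] unfolding \<rho>_def by auto
  have ab\<Theta>: "(named a, named b) \<in> \<Theta>"
    using congruence_trans[OF \<Theta>(1) congruence_trans[OF \<Theta>(1) congruence_sym[OF \<Theta>(1) ya] yz\<Theta>] zb] .
  have cM: "named u \<in> M \<longleftrightarrow> u \<in> H" if u: "u \<in> carr A" for u
  proof -
    have "opn B s [named u] = named (opn A s [u])"
      using homs_opn[OF named_hom, of s "[u]"] s u by simp
    then have "named u \<in> M \<longleftrightarrow> (named (if u \<in> H then t else f), named t) \<in> \<rho>"
      using M_iff[OF named_carr[OF u]] s_opn u by simp
    moreover have "(named t, named t) \<in> \<rho>" by (rule congruence_refl[OF \<rho> named_carr[OF t_carr]])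
    ultimately show ?thesis using ft unfolding \<rho>_def by (cases "u \<in> H") simp_all
  qed
  let ?\<theta> = "{(u, v). u \<in> carr (reduct \<tau> A) \<and> v \<in> carr (reduct \<tau> A) \<and> (named u, named v) \<in> \<Theta>}"
  have "congruence (lang l) (reduct \<tau> A) ?\<theta>"
    by (rule congruence_vimage[OF homs_reduct[OF named_hom A \<tau>] redA \<Theta>(1)])
  moreover have "compatible ?\<theta> H"
    unfolding compatible_def
  proof (intro allI impI)
    fix u v
    assume "u \<in> H" "(u, v) \<in> ?\<theta>"
    then have "named u \<in> M" "(named u, named v) \<in> \<Theta>" "v \<in> carr A" using cM[of u] by simp_all
    then show "v \<in> H" using \<Theta>(2) cM[of v] unfolding compatible_def by blast
  qed
  ultimately have "?\<theta> \<subseteq> leibniz (lang l) (reduct \<tau> A) H" by (rule leibniz_maximal[OF redA])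
  moreover have "(a, b) \<in> ?\<theta>" using ab ab\<Theta> by simp
  ultimately show False using nH by blast
qed

end

text \<open>
  Hence the interpretability of \<open>l\<close> is decided in the test matrix alone: \<open>F\<close> has to be an
  \<open>l\<close>-filter, and the separating \<open>l\<close>-filters, one for each pair of distinct elements, have to be
  tested by unary operations.
\<close>

lemma (in test_matrix) interpretation_of_mlogic:
  assumes l: "is_logic l" and \<tau>: "translation (lang l) L \<tau>"
    and card: "|ords_below (vcard l)| \<le>o |ords_below \<kappa>|"
    and F_filter: "deductive_filter l (reduct \<tau> A) F"
    and sep: "\<And>a b. a \<in> carr A \<Longrightarrow> b \<in> carr A \<Longrightarrow> a \<noteq> b \<Longrightarrow>
      \<exists>H s. deductive_filter l (reduct \<tau> A) H \<and> F \<subseteq> H \<and>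
        (a, b) \<notin> leibniz (lang l) (reduct \<tau> A) H \<and>
        L s = Some 1 \<and> (\<forall>x \<in> carr A. opn A s [x] = (if x \<in> H then t else f))"
  shows "interpretation_of \<tau> l mlogic"
proof -
  have "(reduct \<tau> B, G) \<in> Mod_Suszko l" if BG: "(B, G) \<in> Mod_Suszko mlogic" for B G
  proof -
    note M = Mod_SuszkoD[OF BG]
    have B: "is_algebra L B" using M(1) by simp
    interpret reduced_test_model L A F \<kappa> c q t f B G
      by unfold_locales (rule B, rule M(3), rule M(4))
    note redB = is_algebra_reduct[OF B \<tau>]
    have filt: "deductive_filter l (reduct \<tau> B) G" by (rule reduct_filter[OF l \<tau> card F_filter])
    show ?thesis
    proof (rule Mod_SuszkoI[OF redB _ filt])
      show "small (carr (reduct \<tau> B))" using M(2) by simp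
      fix y z
      assume yz: "(y, z) \<in> suszko l (reduct \<tau> B) G"
      then have "(y, z) \<in> leibniz (lang l) (reduct \<tau> B) G"
        using filt unfolding suszko_leibniz by blast
      then have carr: "y \<in> carr B" "z \<in> carr B"
        using congruence_carr[OF leibniz_congruence[OF redB]] by fastforce+
      show "y = z" by (rule suszko_reduct_trivial[OF l \<tau> card _ yz carr]) (rule sep)
    qed
  qed
  then show ?thesis using \<tau> unfolding interpretation_of_def by auto
qed

lemma (in test_matrix) Mod_Suszko_mlogic:
  assumes "small (carr A)"
  shows "(A, F) \<in> Mod_Suszko mlogic"
proof (rule Mod_SuszkoI)
  show filt: "deductive_filter mlogic A F"
    by (rule deductive_filter_matrix_logic[OF is_logic_mlogic F])
  fix a b
  assume "(a, b) \<in> suszko mlogic A F"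
  then have ab: "(a, b) \<in> leibniz L A F"
    using filt unfolding suszko_leibniz by simp
  note \<theta> = leibniz_congruence[OF A, of F]
  have carr: "a \<in> carr A" "b \<in> carr A" using congruence_carr[OF \<theta> ab] by blast+
  have "(opn A q [a, a, a, a, a, a], opn A q [a, a, a, a, a, b]) \<in> leibniz L A F"
    by (rule congruence_opn[OF \<theta>]) (use ab congruence_refl[OF \<theta> carr(1)] in \<open>simp_all add: q_Suc\<close>)
  moreover have "opn A q [a, a, a, a, a, a] \<in> F" using q_holds carr by simp
  ultimately have "opn A q [a, a, a, a, a, b] \<in> F"
    using leibniz_compatible[OF A, of F] unfolding compatible_def by blast
  then show "a = b" using q_holds carr by simp
qed (use A assms in simp_all)


section \<open>A common upper bound\<close>

text \<open>
  Symbols are elements of the universe, so a set of operations becomes a language through an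
  injection into the universe, and smallness is a bound on the number of operations. Instead of
  designing symbols, it therefore suffices to list the wanted operations.
\<close>

lemma name_operations:
  fixes Ops :: "(nat \<times> ('u list \<Rightarrow> 'u)) set" and C :: "'u set"
  assumes card: "|Ops| <o |UNIV :: 'u set|" and C: "C \<noteq> {}"
    and closed: "\<And>n g us. (n, g) \<in> Ops \<Longrightarrow> length us = n \<Longrightarrow> set us \<subseteq> C \<Longrightarrow> g us \<in> C"
    and pos: "\<And>n g. (n, g) \<in> Ops \<Longrightarrow> 0 < n"
  shows "\<exists>(L :: 'u language) A. is_language L \<and> small (dom L) \<and> carr A = C \<and> is_algebra L A \<and>
    (\<forall>n g. (n, g) \<in> Ops \<longrightarrow> (\<exists>s. L s = Some n \<and> opn A s = g))"
proof -
  obtain j :: "nat \<times> ('u list \<Rightarrow> 'u) \<Rightarrow> 'u" where j: "inj_on j Ops"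
    using card_of_ordLeq[THEN iffD2, OF ordLess_imp_ordLeq[OF card]] by blast
  let ?i = "inv_into Ops j"
  define L where "L s = (if s \<in> j ` Ops then Some (fst (?i s)) else None)" for s
  define A where "A = \<lparr>carr = C, opn = (\<lambda>s. snd (?i s))\<rparr>"
  have Ops: "\<exists>g. (n, g) \<in> Ops \<and> opn A s = g" if "L s = Some n" for s n
  proof -
    have s: "s \<in> j ` Ops" and n: "n = fst (?i s)" using that unfolding L_def by (auto split: if_splits)
    have "?i s \<in> Ops" by (rule inv_into_into[OF s])
    then show ?thesis unfolding n A_def by simp
  qed
  show ?thesis
  proof (rule exI[of _ L], rule exI[of _ A], intro conjI allI impI)
    show "is_language L" using Ops pos unfolding is_language_def by blast
    have "dom L = j ` Ops" unfolding L_def by (auto simp: dom_def)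
    then show "small (dom L)"
      unfolding small_def using ordLeq_ordLess_trans[OF card_of_image card] by simp
    show "carr A = C" unfolding A_def by simp
    show "is_algebra L A"
      unfolding is_algebra_def
    proof (intro conjI allI impI)
      show "carr A \<noteq> {}" using C unfolding A_def by simp
      fix s us
      assume s: "L s = Some (length us)" and us: "set us \<subseteq> carr A"
      obtain g where g: "(length us, g) \<in> Ops" "opn A s = g" using Ops[OF s] by blast
      have "set us \<subseteq> C" using us unfolding A_def by simp
      from closed[OF g(1) refl this] show "opn A s us \<in> carr A" using g(2) unfolding A_def by simp
    qed
    show "\<exists>s. L s = Some n \<and> opn A s = g" if g: "(n, g) \<in> Ops" for n g
    proof
      show "L (j (n, g)) = Some n \<and> opn A (j (n, g)) = g"
        using j g unfolding L_def A_def by simp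
    qed
  qed
qed

lemma separating_filter:
  assumes AF: "(A, F) \<in> Mod_Suszko l" and "a \<noteq> b"
  shows "\<exists>H. deductive_filter l A H \<and> F \<subseteq> H \<and> (a, b) \<notin> leibniz (lang l) A H"
proof -
  have "(a, b) \<notin> suszko l A F" using Mod_SuszkoD(4)[OF AF] assms(2) by blast
  then show ?thesis unfolding suszko_leibniz by blast
qed

definition basic_operations :: "'u language \<Rightarrow> ('u, 'u) algebra \<Rightarrow> (nat \<times> ('u list \<Rightarrow> 'u)) set" where
  "basic_operations L A = {(n, opn A s) | s n. L s = Some n}"

text \<open>
  The unary tests for the filters \<open>H a b\<close>. One filter per pair suffices; the set of all filters could
  exceed the size of the universe.
\<close>

definition filter_tests ::
  "('u \<Rightarrow> 'u \<Rightarrow> 'u set) \<Rightarrow> 'u set \<Rightarrow> 'u \<Rightarrow> 'u \<Rightarrow> (nat \<times> ('u list \<Rightarrow> 'u)) set" where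
  "filter_tests H C t f = {(1, \<lambda>xs. if hd xs \<in> H a b then t else f) | a b. a \<in> C \<and> b \<in> C}"

lemma card_basic_operations: "|dom L| <o r \<Longrightarrow> |basic_operations L A| <o r"
proof -
  assume L: "|dom L| <o r"
  have "basic_operations L A = (\<lambda>s. (the (L s), opn A s)) ` dom L"
    unfolding basic_operations_def by force
  then show ?thesis using ordLeq_ordLess_trans[OF card_of_image L] by simp
qed

lemma card_filter_tests:
  assumes "infinite C" "|C| <o r"
  shows "|filter_tests H C t f| <o r"
proof -
  have "filter_tests H C t f = (\<lambda>(a, b). (1, \<lambda>xs. if hd xs \<in> H a b then t else f)) ` (C \<times> C)"
    unfolding filter_tests_def by auto
  moreover have "|C \<times> C| <o r"
    by (rule ordIso_ordLess_trans[OF card_of_Times_same_infinite[OF assms(1)] assms(2)])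
  ultimately show ?thesis using ordLeq_ordLess_trans[OF card_of_image] by metis
qed

lemma translation_of_names:
  assumes names: "\<And>n g. (n, g) \<in> basic_operations L A \<Longrightarrow> \<exists>s. L' s = Some n \<and> opn A' s = g"
  shows "\<exists>\<tau>. translation L L' \<tau> \<and>
    (\<forall>s as. L s = Some (length as) \<longrightarrow> opn A s as = opn (reduct \<tau> A') s as)"
proof -
  have "\<forall>s. \<exists>s'. \<forall>n. L s = Some n \<longrightarrow> L' s' = Some n \<and> opn A' s' = opn A s"
  proof
    fix s
    show "\<exists>s'. \<forall>n. L s = Some n \<longrightarrow> L' s' = Some n \<and> opn A' s' = opn A s"
    proof (cases "L s")
      case (Some n)
      then have "(n, opn A s) \<in> basic_operations L A" unfolding basic_operations_def by blast
      from names[OF this] show ?thesis using Some by auto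
    qed simp
  qed
  then obtain k where k: "\<forall>s n. L s = Some n \<longrightarrow> L' (k s) = Some n \<and> opn A' (k s) = opn A s"
    by (auto dest!: choice)
  define \<tau> where "\<tau> s = Fn (k s) (map Var [0..<the (L s)])" for s :: 'a
  show ?thesis
  proof (intro exI conjI allI impI)
    show "translation L L' \<tau>" using k unfolding translation_def \<tau>_def by auto
    show "opn A s as = opn (reduct \<tau> A') s as" if s: "L s = Some (length as)" for s as
    proof -
      have "map (eval A' (\<lambda>i. as ! i)) (map Var [0..<length as]) = as"
        by (simp add: comp_def map_nth)
      then show ?thesis using k s unfolding opn_reduct \<tau>_def by (simp del: map_map)
    qed
  qed
qed

lemma (in test_matrix) interpretable_in_mlogic:
  assumes l: "is_logic l" and D: "(D, F) \<in> Mod_Suszko l" "carr D = carr A"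
    and card: "|ords_below (vcard l)| \<le>o |ords_below \<kappa>|"
    and names: "\<And>n g. (n, g) \<in> basic_operations (lang l) D \<Longrightarrow> \<exists>s. L s = Some n \<and> opn A s = g"
    and H: "\<And>a b. a \<noteq> b \<Longrightarrow>
      deductive_filter l D (H a b) \<and> F \<subseteq> H a b \<and> (a, b) \<notin> leibniz (lang l) D (H a b)"
    and tests: "\<And>n g. (n, g) \<in> filter_tests H (carr A) t f \<Longrightarrow> \<exists>s. L s = Some n \<and> opn A s = g"
  shows "interpretable l mlogic"
proof -
  obtain \<tau> where \<tau>: "translation (lang l) L \<tau>"
    and "\<forall>s as. lang l s = Some (length as) \<longrightarrow> opn D s as = opn (reduct \<tau> A) s as"
    using translation_of_names[of "lang l" D L A, OF names] by blast
  then have eq: "opn D s as = opn (reduct \<tau> A) s as" if "lang l s = Some (length as)" for s as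
    using that by blast
  have carr: "carr D = carr (reduct \<tau> A)" using D(2) by simp
  note filt = deductive_filter_opn_cong[OF carr eq]
  have leib: "leibniz (lang l) D = leibniz (lang l) (reduct \<tau> A)"
    by (rule leibniz_opn_cong[OF carr eq])
  have "interpretation_of \<tau> l mlogic"
  proof (rule interpretation_of_mlogic[OF l \<tau> card])
    show "deductive_filter l (reduct \<tau> A) F" using Mod_SuszkoD(3)[OF D(1)] filt by blast
    fix a b
    assume ab: "a \<in> carr A" "b \<in> carr A" "a \<noteq> b"
    then have "(1, \<lambda>xs. if hd xs \<in> H a b then t else f) \<in> filter_tests H (carr A) t f"
      unfolding filter_tests_def by blast
    from tests[OF this] obtain s where
      "L s = Some 1" "opn A s = (\<lambda>xs. if hd xs \<in> H a b then t else f)" by blast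
    then have "L s = Some 1 \<and> (\<forall>x \<in> carr A. opn A s [x] = (if x \<in> H a b then t else f))" by simp
    moreover have "deductive_filter l (reduct \<tau> A) (H a b) \<and> F \<subseteq> H a b \<and>
        (a, b) \<notin> leibniz (lang l) (reduct \<tau> A) (H a b)"
      using H[OF ab(3)] filt leib by simp
    ultimately show "\<exists>H s. deductive_filter l (reduct \<tau> A) H \<and> F \<subseteq> H \<and>
        (a, b) \<notin> leibniz (lang l) (reduct \<tau> A) H \<and>
        L s = Some 1 \<and> (\<forall>x \<in> carr A. opn A s [x] = (if x \<in> H then t else f))" by blast
  qed
  then show ?thesis unfolding interpretable_def by blast
qed

lemma is_logic_infinite_cardinal: "is_logic l \<Longrightarrow> infinite_cardinal (vcard l)"
  and is_logic_small_dom: "is_logic l \<Longrightarrow> small (dom (lang l))"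
  and is_logic_is_language: "is_logic l \<Longrightarrow> is_language (lang l)"
  unfolding is_logic_def by (elim conjE, assumption)+

text \<open>
  Two Suszko-reduced matrices of different logics with the same carrier and the same proper nonempty
  filter give rise to a test matrix: its operations are those of both algebras, the tests for
  separating filters of both logics, the constants and \<open>q\<close>. Both logics are then interpreted in its
  logic, which moreover has a reduced model with the given filter. The larger of the two sets of
  variables serves as \<open>\<kappa>\<close>.
\<close>

lemma common_upper_bound:
  fixes l1 l2 :: "'u logical_system"
  assumes l1: "is_logic l1" and l2: "is_logic l2"
    and A1: "(A1, F) \<in> Mod_Suszko l1" and A2: "(A2, F) \<in> Mod_Suszko l2"
    and carr: "carr A1 = carr A2" and C: "infinite (carr A1)"
    and t: "t \<in> F" and f: "f \<in> carr A1" "f \<notin> F"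
  shows "\<exists>l A. is_logic l \<and> interpretable l1 l \<and> interpretable l2 l \<and> (A, F) \<in> Mod_Suszko l"
proof -
  define C where "C = carr A1"
  let ?r = "|UNIV :: 'u set|"
  have C1: "carr A1 = C" and C2: "carr A2 = C" and infC: "infinite C"
    using carr C unfolding C_def by simp_all
  have smC: "|C| <o ?r" using Mod_SuszkoD(2)[OF A1] unfolding C_def small_def .
  have tC: "t \<in> C" using t deductive_filter_subset[OF Mod_SuszkoD(3)[OF A1]] C1 by blast
  have fC: "f \<in> C" using f C1 by simp
  have U: "infinite (UNIV :: 'u set)" using infC by (rule contrapos_nn) (rule finite_subset[OF subset_UNIV])
  have "\<forall>a b. \<exists>H. a \<noteq> b \<longrightarrow>
      deductive_filter l1 A1 H \<and> F \<subseteq> H \<and> (a, b) \<notin> leibniz (lang l1) A1 H"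
    using separating_filter[OF A1] by blast
  then obtain H1 where H1: "\<And>a b. a \<noteq> b \<Longrightarrow>
      deductive_filter l1 A1 (H1 a b) \<and> F \<subseteq> H1 a b \<and> (a, b) \<notin> leibniz (lang l1) A1 (H1 a b)"
    by metis
  have "\<forall>a b. \<exists>H. a \<noteq> b \<longrightarrow>
      deductive_filter l2 A2 H \<and> F \<subseteq> H \<and> (a, b) \<notin> leibniz (lang l2) A2 H"
    using separating_filter[OF A2] by blast
  then obtain H2 where H2: "\<And>a b. a \<noteq> b \<Longrightarrow>
      deductive_filter l2 A2 (H2 a b) \<and> F \<subseteq> H2 a b \<and> (a, b) \<notin> leibniz (lang l2) A2 (H2 a b)"
    by metis
  define qop where
    "qop xs = (if xs ! 0 = xs ! 2 \<and> xs ! 1 = xs ! 3 \<and> xs ! 4 \<noteq> xs ! 5 then f else t)" for xs :: "'u list"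
  define const_ops where "const_ops = (\<lambda>u. (1 :: nat, \<lambda>_ :: 'u list. u)) ` C"
  define Ops where "Ops = basic_operations (lang l1) A1 \<union> basic_operations (lang l2) A2 \<union>
    filter_tests H1 C t f \<union> filter_tests H2 C t f \<union> const_ops \<union> {(6, qop)}"
  have Un: "|X \<union> Y| <o ?r" if "|X| <o ?r" "|Y| <o ?r" for X Y :: "(nat \<times> ('u list \<Rightarrow> 'u)) set"
    by (rule card_of_Un_ordLess_infinite[OF U that])
  have card: "|Ops| <o ?r"
    unfolding Ops_def
  proof (intro Un)
    show "|basic_operations (lang l1) A1| <o ?r"
      by (rule card_basic_operations[OF is_logic_small_dom[OF l1, unfolded small_def]])
    show "|basic_operations (lang l2) A2| <o ?r"
      by (rule card_basic_operations[OF is_logic_small_dom[OF l2, unfolded small_def]])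
    show "|filter_tests H1 C t f| <o ?r" "|filter_tests H2 C t f| <o ?r"
      by (rule card_filter_tests[OF infC smC])+
    show "|const_ops| <o ?r"
      unfolding const_ops_def by (rule ordLeq_ordLess_trans[OF card_of_image smC])
    show "|{(6 :: nat, qop)}| <o ?r"
      using U by (intro finite_ordLess_infinite) (simp_all add: card_of_well_order_on Field_card_of)
  qed
  have pos: "0 < n" if "(n, g) \<in> Ops" for n g
    using that is_logic_is_language[OF l1] is_logic_is_language[OF l2]
    unfolding Ops_def basic_operations_def filter_tests_def const_ops_def is_language_def by auto
  have closed: "g us \<in> C" if g: "(n, g) \<in> Ops" and us: "length us = n" "set us \<subseteq> C" for n g us
  proof -
    consider "(n, g) \<in> basic_operations (lang l1) A1" | "(n, g) \<in> basic_operations (lang l2) A2"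
      | "(n, g) \<in> filter_tests H1 C t f \<union> filter_tests H2 C t f \<union> const_ops \<union> {(6, qop)}"
      using g unfolding Ops_def by blast
    then show ?thesis
    proof cases
      case 1
      then obtain s where "lang l1 s = Some n" "g = opn A1 s" unfolding basic_operations_def by blast
      then show ?thesis using is_algebraD[OF Mod_SuszkoD(1)[OF A1], of s us] us C1 by simp
    next
      case 2
      then obtain s where "lang l2 s = Some n" "g = opn A2 s" unfolding basic_operations_def by blast
      then show ?thesis using is_algebraD[OF Mod_SuszkoD(1)[OF A2], of s us] us C2 by simp
    next
      case 3
      then show ?thesis
        using tC fC unfolding filter_tests_def const_ops_def qop_def by auto
    qed
  qed
  have C_ne: "C \<noteq> {}" using tC by blast
  have "\<exists>(L :: 'u language) A. is_language L \<and> small (dom L) \<and> carr A = C \<and> is_algebra L A \<and>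
      (\<forall>n g. (n, g) \<in> Ops \<longrightarrow> (\<exists>s. L s = Some n \<and> opn A s = g))"
  proof (rule name_operations[OF card C_ne])
    show "g us \<in> C" if "(n, g) \<in> Ops" "length us = n" "set us \<subseteq> C" for n g us
      by (rule closed[OF that])
    show "0 < n" if "(n, g) \<in> Ops" for n g by (rule pos[OF that])
  qed
  then obtain L :: "'u language" and A where L: "is_language L" "small (dom L)"
    and A_carr: "carr A = C" and A_alg: "is_algebra L A"
    and "\<forall>n g. (n, g) \<in> Ops \<longrightarrow> (\<exists>s. L s = Some n \<and> opn A s = g)" by (elim exE conjE)
  then have names: "\<exists>s. L s = Some n \<and> opn A s = g" if "(n, g) \<in> Ops" for n g
    using that by blast
  obtain \<kappa> :: 'u where \<kappa>: "infinite_cardinal \<kappa>"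
    and \<kappa>1: "|ords_below (vcard l1)| \<le>o |ords_below \<kappa>|"
    and \<kappa>2: "|ords_below (vcard l2)| \<le>o |ords_below \<kappa>|"
  proof -
    have "|ords_below (vcard l1)| \<le>o |ords_below (vcard l2)| \<or>
        |ords_below (vcard l2)| \<le>o |ords_below (vcard l1)|"
      by (rule ordLeq_total) (rule card_of_Well_order)+
    then show thesis
    proof
      assume "|ords_below (vcard l1)| \<le>o |ords_below (vcard l2)|"
      then show thesis
        by (rule that[OF is_logic_infinite_cardinal[OF l2]]) (rule ordLeq_refl[OF card_of_Card_order])
    next
      assume "|ords_below (vcard l2)| \<le>o |ords_below (vcard l1)|"
      then show thesis
        by (rule that[OF is_logic_infinite_cardinal[OF l1] ordLeq_refl[OF card_of_Card_order]])
    qed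
  qed
  have "\<forall>u \<in> C. \<exists>s. L s = Some 1 \<and> opn A s = (\<lambda>_. u)"
  proof
    fix u assume "u \<in> C"
    then have "(1, \<lambda>_. u) \<in> Ops" unfolding Ops_def const_ops_def by blast
    then show "\<exists>s. L s = Some 1 \<and> opn A s = (\<lambda>_. u)" by (rule names)
  qed
  then obtain c where c: "\<forall>u \<in> C. L (c u) = Some 1 \<and> opn A (c u) = (\<lambda>_. u)" by metis
  have "(6, qop) \<in> Ops" unfolding Ops_def by blast
  then obtain q where q: "L q = Some 6" "opn A q = qop" using names by blast
  have F: "F \<subseteq> C" using deductive_filter_subset[OF Mod_SuszkoD(3)[OF A1]] C1 by simp
  interpret test_matrix L A F \<kappa> c q t f
  proof
    show "opn A q [y, z, y', z', x, x'] = (if y = y' \<and> z = z' \<and> x \<noteq> x' then f else t)" for y z y' z' x x'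
      unfolding q(2) qop_def by (simp add: numeral_eq_Suc)
  qed (use L A_carr A_alg F \<kappa> t f c q C1 in simp_all)
  have D: "carr A1 = carr A" "carr A2 = carr A" using C1 C2 A_carr by simp_all
  have "interpretable l1 mlogic"
    by (rule interpretable_in_mlogic[OF l1 A1 D(1) \<kappa>1 names H1 names])
      (simp_all add: Ops_def A_carr)
  moreover have "interpretable l2 mlogic"
    by (rule interpretable_in_mlogic[OF l2 A2 D(2) \<kappa>2 names H2 names])
      (simp_all add: Ops_def A_carr)
  moreover have "(A, F) \<in> Mod_Suszko mlogic"
    by (rule Mod_Suszko_mlogic) (use smC A_carr in \<open>simp add: small_def\<close>)
  ultimately show ?thesis using is_logic_mlogic by blast
qed


section \<open>Assertional logics are meet-prime\<close>

text \<open>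
  No filter lies properly above the total one, whose Leibniz congruence is total; so a Suszko-reduced matrix
  with total filter is trivial.
\<close>

lemma Mod_Suszko_total_filter:
  assumes AF: "(A, carr A) \<in> Mod_Suszko l" and ab: "a \<in> carr A" "b \<in> carr A"
  shows "a = b"
proof (rule Mod_SuszkoD(4)[OF AF])
  note A = Mod_SuszkoD(1)[OF AF]
  have "congruence (lang l) A (carr A \<times> carr A)"
  proof (rule congruenceI)
    fix s as bs
    assume s: "lang l s = Some (length as)"
      and asbs: "list_all2 (\<lambda>a b. (a, b) \<in> carr A \<times> carr A) as bs"
    have "set as \<subseteq> carr A" "set bs \<subseteq> carr A"
      using asbs by (induction rule: list_all2_induct) auto
    then show "(opn A s as, opn A s bs) \<in> carr A \<times> carr A"
      using is_algebraD[OF A, of s as] is_algebraD[OF A, of s bs] s list_all2_lengthD[OF asbs] by simp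
  qed auto
  then have "carr A \<times> carr A \<subseteq> leibniz (lang l) A (carr A)"
    by (rule leibniz_maximal[OF A]) (auto simp: compatible_def)
  moreover have "G = carr A" if "deductive_filter l A G" "carr A \<subseteq> G" for G
    using deductive_filter_subset[OF that(1)] that(2) by blast
  ultimately show "(a, b) \<in> suszko l A (carr A)"
    using ab unfolding suszko_leibniz by blast
qed

lemma theorem_in_filter:
  assumes l: "is_logic l" "has_theorems l" and AF: "(A, F) \<in> Mod_Suszko l"
  shows "F \<noteq> {}"
proof -
  note A = Mod_SuszkoD[OF AF]
  obtain \<phi> where ent: "entails l {} \<phi>" using l(2) unfolding has_theorems_def by blast
  obtain a where "a \<in> carr A" using A(1) unfolding is_algebra_def by blast
  then have "(\<lambda>_. a) ` ords_below (vcard l) \<subseteq> carr A" by blast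
  then have "eval A (\<lambda>_. a) \<phi> \<in> F"
    by (rule deductive_filter_eval[OF A(3,1) ent]) simp
  then show ?thesis by blast
qed

text \<open>
  A theorem makes every filter nonempty, so a filter that violates assertionality has two elements,
  and by \<open>Mod_Suszko_total_filter\<close> it is proper. Interpretations preserve the filter, which carries
  the model over to \<open>l'\<close>.
\<close>

lemma non_assertional_model:
  assumes l: "is_logic l" "has_theorems l" "\<not> assertional l"
    and int: "interpretable l' l"
  obtains A F p r w where "(A, F) \<in> Mod_Suszko l'" "p \<in> F" "r \<in> F" "p \<noteq> r" "w \<in> carr A" "w \<notin> F"
proof -
  obtain B F where BF: "(B, F) \<in> Mod_Suszko l" and ns: "\<not> is_singleton F"
    using l(3) unfolding assertional_def by blast
  obtain \<tau> where "interpretation_of \<tau> l' l" using int unfolding interpretable_def by blast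
  then have AF: "(reduct \<tau> B, F) \<in> Mod_Suszko l'" using BF unfolding interpretation_of_def by auto
  have "F \<noteq> {}" by (rule theorem_in_filter[OF l(1,2) BF])
  then have "\<exists>p \<in> F. \<exists>r \<in> F. p \<noteq> r" using ns is_singletonI'[of F] by blast
  then obtain p r where p: "p \<in> F" and r: "r \<in> F" "p \<noteq> r" by blast
  have sub: "F \<subseteq> carr B" by (rule deductive_filter_subset[OF Mod_SuszkoD(3)[OF BF]])
  have "F \<noteq> carr B"
  proof
    assume "F = carr B"
    then show False using Mod_Suszko_total_filter[of B l p r] BF p r by simp
  qed
  then obtain w where "w \<in> carr (reduct \<tau> B)" "w \<notin> F" using sub by auto
  then show thesis by (rule that[OF AF p r])
qed

theorem theorem5p11:
  fixes K1 K2 :: "'u logical_system set"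
  assumes "leibniz_class K1" and "leibniz_class K2"
    and "\<forall>l \<in> K1. has_theorems l" and "\<forall>l \<in> K2. has_theorems l"
    and "\<forall>l \<in> K1 \<inter> K2. assertional l"
  shows "(\<forall>l \<in> K1. assertional l) \<or> (\<forall>l \<in> K2. assertional l)"
proof (rule ccontr)
  assume "\<not> ?thesis"
  then obtain k1 k2 where k: "k1 \<in> K1" "k2 \<in> K2" "\<not> assertional k1" "\<not> assertional k2" by blast
  obtain \<Phi>1 where \<Phi>1: "leibniz_condition \<Phi>1" "K1 = Log \<Phi>1"
    using assms(1) unfolding leibniz_class_def by blast
  obtain \<Phi>2 where \<Phi>2: "leibniz_condition \<Phi>2" "K2 = Log \<Phi>2"
    using assms(2) unfolding leibniz_class_def by blast
  obtain \<alpha> where k1: "is_logic k1" "interpretable (\<Phi>1 \<alpha>) k1" using k(1) \<Phi>1(2) unfolding Log_def by blast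
  obtain \<beta> where k2: "is_logic k2" "interpretable (\<Phi>2 \<beta>) k2" using k(2) \<Phi>2(2) unfolding Log_def by blast
  define l1 where "l1 = \<Phi>1 \<alpha>"
  define l2 where "l2 = \<Phi>2 \<beta>"
  have l: "is_logic l1" "is_logic l2"
    using \<Phi>1(1) \<Phi>2(1) unfolding l1_def l2_def leibniz_condition_def by blast+
  have th: "has_theorems k1" "has_theorems k2" using assms(3,4) k(1,2) by blast+
  obtain A1 F1 p1 r1 w1 where A1: "(A1, F1) \<in> Mod_Suszko l1"
    "p1 \<in> F1" "r1 \<in> F1" "p1 \<noteq> r1" "w1 \<in> carr A1" "w1 \<notin> F1"
    by (rule non_assertional_model[OF k1(1) th(1) k(3) k1(2)[folded l1_def]])
  obtain A2 F2 p2 r2 w2 where A2: "(A2, F2) \<in> Mod_Suszko l2"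
    "p2 \<in> F2" "r2 \<in> F2" "p2 \<noteq> r2" "w2 \<in> carr A2" "w2 \<notin> F2"
    by (rule non_assertional_model[OF k2(1) th(2) k(4) k2(2)[folded l2_def]])
  let ?r = "|UNIV :: 'u set|"
  \<comment> \<open>A common size for both powers: infinite, small, and at least the size of either carrier.\<close>
  define I where "I = ords_below (vcard l1) \<union> (carr A1 \<union> carr A2)"
  have infO: "infinite (ords_below (vcard l1))"
    by (rule infinite_cardinal_infinite[OF is_logic_infinite_cardinal[OF l(1)]])
  then have infI: "infinite I" unfolding I_def by simp
  have U: "infinite (UNIV :: 'u set)" using infI by (rule contrapos_nn) (rule finite_subset[OF subset_UNIV])
  have "|ords_below (vcard l1)| <o ?r"
    unfolding ords_below_def by (rule card_of_underS) (simp_all add: card_of_card_order_on Field_card_of)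
  moreover have "|carr A1| <o ?r" "|carr A2| <o ?r"
    using Mod_SuszkoD(2)[OF A1(1)] Mod_SuszkoD(2)[OF A2(1)] unfolding small_def .
  ultimately have smI: "|I| <o ?r"
    unfolding I_def by (intro card_of_Un_ordLess_infinite[OF U])
  have le: "|carr A1| \<le>o |I|" "|carr A2| \<le>o |I|"
    unfolding I_def by (rule card_of_mono1, blast)+
  \<comment> \<open>Split \<open>I\<close> into halves of full cardinality, one for the filter and one for its complement.\<close>
  obtain \<iota> where \<iota>: "bij_betw \<iota> (I <+> I) I"
    using card_of_Plus_infinite(1)[OF infI ordLeq_refl[OF card_of_Card_order]] card_of_ordIso by blast
  define X where "X = \<iota> ` (Inl ` I)"
  define Y where "Y = \<iota> ` (Inr ` I)"
  have inj: "inj_on \<iota> (I <+> I)" using \<iota> by (rule bij_betw_imp_inj_on)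
  have XY: "X \<inter> Y = {}"
    unfolding X_def Y_def using inj by (subst inj_on_image_Int[symmetric]) auto
  have "bij_betw (\<lambda>i. \<iota> (Inl i)) I X" "bij_betw (\<lambda>i. \<iota> (Inr i)) I Y"
    unfolding X_def Y_def bij_betw_def using inj by (auto simp: inj_on_def image_image)
  then have cXY: "|X| =o |I|" "|Y| =o |I|"
    using card_of_ordIsoI ordIso_symmetric by blast+
  have "X \<union> Y \<subseteq> I" unfolding X_def Y_def using bij_betw_imp_surj_on[OF \<iota>] by auto
  then have sm: "small (X \<union> Y)"
    unfolding small_def by (rule ordLeq_ordLess_trans[OF card_of_mono1 smI])
  obtain D1 where D1: "carr D1 = X \<union> Y" "(D1, X) \<in> Mod_Suszko l1"
    using Mod_Suszko_resize[OF l(1) A1 infI le(1) XY cXY sm] by blast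
  obtain D2 where D2: "carr D2 = X \<union> Y" "(D2, X) \<in> Mod_Suszko l2"
    using Mod_Suszko_resize[OF l(2) A2 infI le(2) XY cXY sm] by blast
  have infX: "infinite X" "infinite Y"
    using card_of_ordIso_finite[OF cXY(1)] card_of_ordIso_finite[OF cXY(2)] infI by blast+
  then obtain t f where t: "t \<in> X" and f: "f \<in> Y" by (metis ex_in_conv finite.emptyI)
  have "infinite (carr D1)" "f \<in> carr D1" "f \<notin> X" using infX f XY D1(1) by auto
  then obtain l A where l: "is_logic l" "interpretable l1 l" "interpretable l2 l" "(A, X) \<in> Mod_Suszko l"
    using common_upper_bound[OF l D1(2) D2(2) D1(1)[folded D2(1)] _ t] by blast
  have "l \<in> K1 \<inter> K2" using l(1-3) unfolding \<Phi>1(2) \<Phi>2(2) Log_def l1_def l2_def by blast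
  then have "is_singleton X" using assms(5) l(4) unfolding assertional_def by blast
  then show False using infX(1) unfolding is_singleton_def by auto
qed

end
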